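(* Let $1.667\le\alpha\le\alpha_c(1)\approx 1.8159$. Then there exist $0<\eta_3^*<\beta_3^*<1$ and a constant $c^*>0$ such that the following holds: there exist $c'>0$ and $n_0$ such that for all $n\ge n_0$ and every $\mathcal{I}\subset[0,\pi/2]$ with $|\mathcal{I}|\le 2^{c^*n}$, \[ \mathbb{P}\bigl[\mathcal{S}(\beta_3^*,\eta_3^*,3,\alpha,\mathcal{I})\neq\varnothing\bigr]\le 2^{-c'n}. \]
   Context: Let $\mathcal{B}_n=\{-1,1\}^n$ and $\alpha_c(\kappa)=-1/\log_2\mathbb{P}[|Z|\le\kappa]$ with $Z\sim\mathcal{N}(0,1)$. Given $\alpha>0$, $m\in\mathbb{N}$, $0<\eta<\beta<1$ and $\mathcal{I}\subset[0,\pi/2]$, set $M=\lfloor n\alpha\rfloor$, let $\mathcal{M}_0,\dots,\mathcal{M}_m$ be i.i.d. $M\times n$ random matrices with i.i.d. $\mathcal{N}(0,1)$ entries and $\mathcal{M}_i(\tau)=\cos(\tau)\mathcal{M}_0+\sin(\tau)\mathcal{M}_i$. The random set $\mathcal{S}(\beta,\eta,m,\alpha,\mathcal{I})$ consists of all $(\sigma^{(1)},\dots,\sigma^{(m)})\in\mathcal{B}_n^m$ such that (a) $\beta-\eta\le n^{-1}\langle\sigma^{(i)},\sigma^{(j)}\rangle\le\beta$ for all $i<j$, and (b) there exist $\tau_1,\dots,\tau_m\in\mathcal{I}$ with $\|\mathcal{M}_i(\tau_i)\sigma^{(i)}\|_\infty\le\sqrt n$ for all $i$. *)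

theory Defs
  imports "HOL-Probability.Probability"
begin

definition std_gaussian :: "real measure" where
  "std_gaussian = density lborel std_normal_density"

definition critical_ratio :: "real \<Rightarrow> real" where
  "critical_ratio \<kappa> = - 1 / log 2 (measure std_gaussian {z. \<bar>z\<bar> \<le> \<kappa>})"

text \<open>
  Since the dimension varies, a vector of length \<open>n\<close> is a function on \<open>{..<n}\<close> and an
  \<open>M \<times> n\<close> matrix is a function \<open>nat \<Rightarrow> nat \<Rightarrow> real\<close> of which only the entries with row index
  below \<open>M\<close> and column index below \<open>n\<close> are used.  Vectors in the cube are taken extensional,
  so that distinct elements really are distinct sign vectors.
\<close>

definition sign_cube :: "nat \<Rightarrow> (nat \<Rightarrow> real) set" where
  "sign_cube n = {..<n} \<rightarrow>\<^sub>E {-1, 1}"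

definition dot :: "nat \<Rightarrow> (nat \<Rightarrow> real) \<Rightarrow> (nat \<Rightarrow> real) \<Rightarrow> real" where
  "dot n x y = (\<Sum>b<n. x b * y b)"

definition mat_vec :: "nat \<Rightarrow> (nat \<Rightarrow> nat \<Rightarrow> real) \<Rightarrow> (nat \<Rightarrow> real) \<Rightarrow> nat \<Rightarrow> real" where
  "mat_vec n A x = (\<lambda>a. \<Sum>b<n. A a b * x b)"

text \<open>Inserting \<open>0\<close> only matters for \<open>M = 0\<close>, where the norm of the empty vector is \<open>0\<close>.\<close>

definition sup_norm :: "nat \<Rightarrow> (nat \<Rightarrow> real) \<Rightarrow> real" where
  "sup_norm M v = Max (insert 0 ((\<lambda>a. \<bar>v a\<bar>) ` {..<M}))"

definition num_constraints :: "real \<Rightarrow> nat \<Rightarrow> nat" where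
  "num_constraints \<alpha> n = nat \<lfloor>real n * \<alpha>\<rfloor>"

text \<open>
  The joint law of \<open>m + 1\<close> independent \<open>M \<times> n\<close> matrices with i.i.d. standard normal entries,
  realised on its canonical space: for a sample point \<open>\<omega>\<close>, the number \<open>\<omega> (i, a, b)\<close> is the entry
  in row \<open>a\<close> and column \<open>b\<close> of the \<open>i\<close>-th matrix, \<open>i = 0, \<dots>, m\<close>.
\<close>

definition gaussian_matrices :: "nat \<Rightarrow> nat \<Rightarrow> nat \<Rightarrow> (nat \<times> nat \<times> nat \<Rightarrow> real) measure" where
  "gaussian_matrices m M n = Pi\<^sub>M ({0..m} \<times> {..<M} \<times> {..<n}) (\<lambda>_. std_gaussian)"

definition interpolated ::
    "(nat \<times> nat \<times> nat \<Rightarrow> real) \<Rightarrow> nat \<Rightarrow> real \<Rightarrow> nat \<Rightarrow> nat \<Rightarrow> real" where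
  "interpolated \<omega> i \<tau> = (\<lambda>a b. cos \<tau> * \<omega> (0, a, b) + sin \<tau> * \<omega> (i, a, b))"

definition solution_tuples ::
    "real \<Rightarrow> real \<Rightarrow> nat \<Rightarrow> real \<Rightarrow> real set \<Rightarrow> nat \<Rightarrow> (nat \<times> nat \<times> nat \<Rightarrow> real)
      \<Rightarrow> (nat \<Rightarrow> nat \<Rightarrow> real) set" where
  "solution_tuples \<beta> \<eta> m \<alpha> \<I> n \<omega> =
    {\<sigma> \<in> {1..m} \<rightarrow>\<^sub>E sign_cube n.
      (\<forall>i\<in>{1..m}. \<forall>j\<in>{1..m}. i < j \<longrightarrow>
        \<beta> - \<eta> \<le> dot n (\<sigma> i) (\<sigma> j) / real n \<and> dot n (\<sigma> i) (\<sigma> j) / real n \<le> \<beta>) \<and>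
      (\<exists>\<tau> \<in> {1..m} \<rightarrow> \<I>. \<forall>i\<in>{1..m}.
        sup_norm (num_constraints \<alpha> n) (mat_vec n (interpolated \<omega> i (\<tau> i)) (\<sigma> i)) \<le> sqrt (real n))}"

end

theory Submission
  imports Defs
begin

text \<open>
  The proof is a first moment computation.  Writing \<open>Y\<^sub>i\<close> for an entry of
  \<open>n\<^sup>-\<^sup>1\<^sup>/\<^sup>2 M\<^sub>i(\<tau>\<^sub>i) \<sigma>\<^sup>(\<^sup>i\<^sup>)\<close>, the three standard Gaussians \<open>Y\<^sub>1, Y\<^sub>2, Y\<^sub>3\<close> have covariances
  \<open>cos \<tau>\<^sub>i cos \<tau>\<^sub>j \<rho>\<^sub>i\<^sub>j\<close>, where \<open>\<rho>\<^sub>i\<^sub>j\<close> are the overlaps.  For three variables with positive overlaps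
  this is a one-factor law, \<open>Y\<^sub>i = l\<^sub>i g + (1 - l\<^sub>i\<^sup>2)\<^sup>1\<^sup>/\<^sup>2 z\<^sub>i\<close> with \<open>l\<^sub>i = cos \<tau>\<^sub>i (\<rho>\<^sub>i\<^sub>j \<rho>\<^sub>i\<^sub>k / \<rho>\<^sub>j\<^sub>k)\<^sup>1\<^sup>/\<^sup>2\<close>, so that
  the probability that all \<open>\<bar>Y\<^sub>i\<bar> \<le> 1\<close> is \<open>E (q\<^sub>1(g) q\<^sub>2(g) q\<^sub>3(g))\<close>, where \<open>q\<^sub>i(g)\<close> is the conditional
  probability of \<open>\<bar>Y\<^sub>i\<bar> \<le> 1\<close>.  By the inequality of arithmetic and geometric means it suffices to
  treat \<open>E q\<^sub>i(g)\<^sup>3\<close>, and since a smaller loading means an Ornstein-Uhlenbeck average of the same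
  function, Jensen's inequality reduces every angle and every overlap to the extremal loading
  \<open>l = 20 / 409\<^sup>1\<^sup>/\<^sup>2\<close>.

  For this loading let \<open>m\<close> be the minimum of \<open>z\<^sub>1, z\<^sub>2, z\<^sub>3\<close>.  Up to a negligible error the event is
  \<open>\<bar>g\<bar> \<le> (1 + (1 - l\<^sup>2)\<^sup>1\<^sup>/\<^sup>2 m) / l\<close>, and a quartic upper bound for \<open>P(\<bar>g\<bar> \<le> t)\<close> together with the exact
  moments of \<open>m\<close> gives \<open>0.6205\<close>.  The number of triples of sign vectors with all overlaps at least
  \<open>\<rho>\<close> is estimated by an exponential moment, and the two exponents add up to a negative number.
\<close>

section \<open>Linear images of Gaussian vectors\<close>

lemma sets_std_gaussian [simp, measurable_cong]: "sets std_gaussian = sets borel"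
  and space_std_gaussian [simp]: "space std_gaussian = UNIV"
  by (simp_all add: std_gaussian_def)

interpretation std_gaussian: prob_space std_gaussian
  unfolding std_gaussian_def by (rule prob_space_normal_density) simp

section \<open>Rotation invariance of a pair of independent standard Gaussians\<close>

lemma nn_integral_std_gaussian:
  assumes [measurable]: "f \<in> borel_measurable borel"
  shows "(\<integral>\<^sup>+x. f x \<partial>std_gaussian) = (\<integral>\<^sup>+x. ennreal (std_normal_density x) * f x \<partial>lborel)"
  unfolding std_gaussian_def by (subst nn_integral_density) auto

text \<open>Two one-dimensional substitutions with an exchange of integrals in between:
  \<open>p = c * x - s * y\<close> for \<open>y\<close> at fixed \<open>x\<close>, then
  \<open>x = c * p + s * y\<close> for \<open>x\<close> at fixed \<open>p\<close>. Both have
  Jacobian \<open>\<bar>s\<bar>\<close>, so the factors cancel; this is where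
  \<open>s \<noteq> 0\<close> enters.\<close>

lemma lborel_rotation:
  fixes c s :: real and f :: "real \<Rightarrow> real \<Rightarrow> ennreal"
  assumes cs: "c\<^sup>2 + s\<^sup>2 = 1" and s: "s \<noteq> 0"
  assumes [measurable]: "case_prod f \<in> borel_measurable (borel \<Otimes>\<^sub>M borel)"
  shows "(\<integral>\<^sup>+x. \<integral>\<^sup>+y. f (c * x - s * y) (s * x + c * y) \<partial>lborel \<partial>lborel)
         = (\<integral>\<^sup>+x. \<integral>\<^sup>+y. f x y \<partial>lborel \<partial>lborel)"
proof -
  \<comment> \<open>The common middle form in the coordinates \<open>x\<close> and \<open>p\<close>,
    where \<open>s * x + c * y\<close> becomes \<open>(x - c * p) / s\<close>.\<close>
  define K where "K = (\<integral>\<^sup>+x. \<integral>\<^sup>+p. f p ((x - c * p) / s) \<partial>lborel \<partial>lborel)"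
  have *: "f (c * x - s * y) (s * x + c * y) = f (c * x + (-s) * y) ((x - c * (c * x + (-s) * y)) / s)" for x y
  proof -
    have "x - c * (c * x - s * y) = x * (1 - c\<^sup>2) + s * c * y"
      by (simp add: algebra_simps power2_eq_square)
    also have "\<dots> = s * (s * x + c * y)"
      using cs by algebra
    finally show ?thesis using s by simp
  qed
  have "ennreal \<bar>s\<bar> * (\<integral>\<^sup>+x. \<integral>\<^sup>+y. f (c * x - s * y) (s * x + c * y) \<partial>lborel \<partial>lborel)
      = (\<integral>\<^sup>+x. ennreal \<bar>-s\<bar> * (\<integral>\<^sup>+y. f (c * x + (-s) * y) ((x - c * (c * x + (-s) * y)) / s) \<partial>lborel) \<partial>lborel)"
    unfolding * by (subst nn_integral_cmult) auto
  also have "\<dots> = K"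
    unfolding K_def using s
    by (intro nn_integral_cong nn_integral_real_affine[symmetric]) auto
  also have "K = (\<integral>\<^sup>+p. \<integral>\<^sup>+x. f p ((x - c * p) / s) \<partial>lborel \<partial>lborel)"
    unfolding K_def by (rule lborel_pair.Fubini') measurable
  also have "\<dots> = (\<integral>\<^sup>+p. ennreal \<bar>s\<bar> * (\<integral>\<^sup>+y. f p ((c * p + s * y - c * p) / s) \<partial>lborel) \<partial>lborel)"
    using s by (intro nn_integral_cong nn_integral_real_affine) auto
  also have "\<dots> = (\<integral>\<^sup>+p. ennreal \<bar>s\<bar> * (\<integral>\<^sup>+y. f p y \<partial>lborel) \<partial>lborel)"
    using s by simp
  also have "\<dots> = ennreal \<bar>s\<bar> * (\<integral>\<^sup>+p. \<integral>\<^sup>+y. f p y \<partial>lborel \<partial>lborel)"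
    by (subst nn_integral_cmult) auto
  finally show ?thesis
    using s by (simp add: ennreal_mult_cancel_left)
qed

lemma std_normal_density_rotation:
  assumes "c\<^sup>2 + s\<^sup>2 = (1::real)"
  shows "std_normal_density (c * x - s * y) * std_normal_density (s * x + c * y)
         = std_normal_density x * std_normal_density y"
proof -
  have "(c * x - s * y)\<^sup>2 + (s * x + c * y)\<^sup>2 = (c\<^sup>2 + s\<^sup>2) * (x\<^sup>2 + y\<^sup>2)"
    by algebra
  then have "exp (- (c * x - s * y)\<^sup>2 / 2) * exp (- (s * x + c * y)\<^sup>2 / 2) = exp (- x\<^sup>2 / 2) * exp (- y\<^sup>2 / 2)"
    using assms by (simp add: exp_add[symmetric] add_divide_distrib[symmetric])
  then show ?thesis
    by (simp add: std_normal_density_def)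
qed

text \<open>The product density is constant on circles, so it passes through the rotation of
  Lebesgue measure. The sign condition on \<open>c\<close> turns the remaining case
  \<open>s = 0\<close> into the identity map.\<close>

lemma std_gaussian_rotation:
  fixes c s :: real and f :: "real \<Rightarrow> real \<Rightarrow> ennreal"
  assumes cs: "c\<^sup>2 + s\<^sup>2 = 1" and c: "c \<ge> 0"
  assumes [measurable]: "case_prod f \<in> borel_measurable (borel \<Otimes>\<^sub>M borel)"
  shows "(\<integral>\<^sup>+x. \<integral>\<^sup>+y. f (c * x - s * y) (s * x + c * y) \<partial>std_gaussian \<partial>std_gaussian)
         = (\<integral>\<^sup>+x. \<integral>\<^sup>+y. f x y \<partial>std_gaussian \<partial>std_gaussian)"
proof (cases "s = 0")
  case True
  then have "c = 1" using cs c by (simp add: power2_eq_1_iff)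
  then show ?thesis using True by simp
next
  case False
  let ?d = "\<lambda>x. ennreal (std_normal_density x)"
  define g where "g x y = ?d x * ?d y * f x y" for x y
  have [measurable]: "case_prod g \<in> borel_measurable (borel \<Otimes>\<^sub>M borel)"
    unfolding g_def by measurable
  have d: "?d x * ?d y = ?d (c * x - s * y) * ?d (s * x + c * y)" for x y
    using std_normal_density_rotation[OF cs, of x y] by (simp add: ennreal_mult[symmetric])
  have "(\<integral>\<^sup>+x. \<integral>\<^sup>+y. f (c * x - s * y) (s * x + c * y) \<partial>std_gaussian \<partial>std_gaussian)
      = (\<integral>\<^sup>+x. \<integral>\<^sup>+y. g (c * x - s * y) (s * x + c * y) \<partial>lborel \<partial>lborel)"
    by (simp add: nn_integral_std_gaussian nn_integral_cmult[symmetric] g_def d[symmetric] mult.assoc)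
  also have "\<dots> = (\<integral>\<^sup>+x. \<integral>\<^sup>+y. g x y \<partial>lborel \<partial>lborel)"
    by (rule lborel_rotation[OF cs False]) measurable
  also have "\<dots> = (\<integral>\<^sup>+x. \<integral>\<^sup>+y. f x y \<partial>std_gaussian \<partial>std_gaussian)"
    by (simp add: nn_integral_std_gaussian nn_integral_cmult[symmetric] g_def mult.assoc)
  finally show ?thesis .
qed

text \<open>Givens rotation: it carries \<open>(p, q)\<close> to
  \<open>(sqrt (p\<^sup>2 + q\<^sup>2), 0)\<close>. With \<open>p \<ge> 0\<close> it also has
  \<open>c \<ge> 0\<close>, as \<open>std_gaussian_rotation\<close> requires.\<close>

lemma givens_coefficients:
  fixes p q :: real
  assumes "p \<ge> 0"
  obtains c s where "c\<^sup>2 + s\<^sup>2 = 1" "c \<ge> 0" "c * p + s * q = sqrt (p\<^sup>2 + q\<^sup>2)" "c * q = s * p"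
proof (cases "p\<^sup>2 + q\<^sup>2 = 0")
  case True
  then show thesis using that[of 1 0] by (simp add: sum_power2_eq_zero_iff)
next
  case False
  define r where "r = sqrt (p\<^sup>2 + q\<^sup>2)"
  have r: "r > 0" "r\<^sup>2 = p\<^sup>2 + q\<^sup>2"
    using False by (auto simp: r_def sum_power2_gt_zero_iff sum_power2_eq_zero_iff)
  show thesis
  proof (rule that[of "p / r" "q / r"])
    show "(p / r)\<^sup>2 + (q / r)\<^sup>2 = 1"
      using r False by (simp add: power_divide add_divide_distrib[symmetric])
    show "p / r * p + q / r * q = sqrt (p\<^sup>2 + q\<^sup>2)"
      using r unfolding r_def[symmetric]
      by (simp add: field_simps power2_eq_square)
  qed (use assms r in auto)
qed


text \<open>A rank-one update of a Cholesky factor: a fresh Gaussian \<open>t\<close> joins a lower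
  triangular image of \<open>x\<close>, \<open>y\<close>, \<open>z\<close>, and three Givens
  rotations, of \<open>t\<close> against \<open>x\<close>, \<open>y\<close>, \<open>z\<close> in
  turn, remove it again. The six equations say that the Gram matrix grows by the outer product of
  \<open>(u1, u2, u3)\<close> with itself.\<close>

lemma std_gaussian_triangular_absorb:
  fixes l11 l21 l22 l31 l32 l33 u1 u2 u3 :: real
  assumes "l11 \<ge> 0" "l22 \<ge> 0" "l33 \<ge> 0"
  shows "\<exists>m11 m21 m22 m31 m32 m33. m11 \<ge> 0 \<and> m22 \<ge> 0 \<and> m33 \<ge> 0 \<and>
    m11\<^sup>2 = l11\<^sup>2 + u1\<^sup>2 \<and> m11 * m21 = l11 * l21 + u1 * u2 \<and>
    m21\<^sup>2 + m22\<^sup>2 = l21\<^sup>2 + l22\<^sup>2 + u2\<^sup>2 \<and> m11 * m31 = l11 * l31 + u1 * u3 \<and>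
    m21 * m31 + m22 * m32 = l21 * l31 + l22 * l32 + u2 * u3 \<and>
    m31\<^sup>2 + m32\<^sup>2 + m33\<^sup>2 = l31\<^sup>2 + l32\<^sup>2 + l33\<^sup>2 + u3\<^sup>2 \<and>
    (\<forall>f \<in> borel_measurable (borel \<Otimes>\<^sub>M borel \<Otimes>\<^sub>M borel).
      (\<integral>\<^sup>+t. \<integral>\<^sup>+x. \<integral>\<^sup>+y. \<integral>\<^sup>+z.
         f (l11 * x + u1 * t, l21 * x + l22 * y + u2 * t, l31 * x + l32 * y + l33 * z + u3 * t)
         \<partial>std_gaussian \<partial>std_gaussian \<partial>std_gaussian \<partial>std_gaussian)
      = (\<integral>\<^sup>+x. \<integral>\<^sup>+y. \<integral>\<^sup>+z. (f (m11 * x, m21 * x + m22 * y, m31 * x + m32 * y + m33 * z) :: ennreal)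
         \<partial>std_gaussian \<partial>std_gaussian \<partial>std_gaussian))"
proof -
  interpret NN: pair_sigma_finite std_gaussian std_gaussian ..
  obtain c s where cs: "c\<^sup>2 + s\<^sup>2 = 1" "c \<ge> 0" "c * l11 + s * u1 = sqrt (l11\<^sup>2 + u1\<^sup>2)" "c * u1 = s * l11"
    using givens_coefficients[OF assms(1)] by metis
  \<comment> \<open>What remains of the coefficients of \<open>t\<close> after the first rotation,
    which has cleared the first one. \<open>u3''\<close> is what remains after the second.\<close>
  define u2' u3' where u': "u2' = c * u2 - s * l21" "u3' = c * u3 - s * l31"
  obtain c' s' where cs': "c'\<^sup>2 + s'\<^sup>2 = 1" "c' \<ge> 0" "c' * l22 + s' * u2' = sqrt (l22\<^sup>2 + u2'\<^sup>2)"
      "c' * u2' = s' * l22"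
    using givens_coefficients[OF assms(2)] by metis
  define u3'' where u'': "u3'' = c' * u3' - s' * l32"
  obtain c'' s'' where cs'': "c''\<^sup>2 + s''\<^sup>2 = 1" "c'' \<ge> 0" "c'' * l33 + s'' * u3'' = sqrt (l33\<^sup>2 + u3''\<^sup>2)"
      "c'' * u3'' = s'' * l33"
    using givens_coefficients[OF assms(3)] by metis
  define m11 m21 m22 m31 m32 m33 where
    m: "m11 = c * l11 + s * u1" "m21 = c * l21 + s * u2" "m22 = c' * l22 + s' * u2'"
       "m31 = c * l31 + s * u3" "m32 = c' * l32 + s' * u3'" "m33 = c'' * l33 + s'' * u3''"
  have m11: "m11 \<ge> 0" "m11\<^sup>2 = l11\<^sup>2 + u1\<^sup>2"
    unfolding m cs by simp_all
  have m22: "m22 \<ge> 0" "m22\<^sup>2 = l22\<^sup>2 + u2'\<^sup>2"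
    unfolding m cs' by simp_all
  have m33: "m33 \<ge> 0" "m33\<^sup>2 = l33\<^sup>2 + u3''\<^sup>2"
    unfolding m cs'' by simp_all
  have "m11 * m21 = l11 * l21 + u1 * u2"
    unfolding m using cs(1,4) by algebra
  moreover have "m11 * m31 = l11 * l31 + u1 * u3"
    unfolding m using cs(1,4) by algebra
  moreover have e2: "m21\<^sup>2 + u2'\<^sup>2 = l21\<^sup>2 + u2\<^sup>2"
    unfolding m u' using cs(1) by algebra
  moreover have "m21\<^sup>2 + m22\<^sup>2 = l21\<^sup>2 + l22\<^sup>2 + u2\<^sup>2"
    using e2 m22(2) by simp
  moreover have "m21 * m31 + u2' * u3' = l21 * l31 + u2 * u3"
    unfolding m u' using cs(1) by algebra
  moreover have "m22 * m32 = l22 * l32 + u2' * u3'"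
    unfolding m using cs'(1,4) by algebra
  moreover have "m31\<^sup>2 + u3'\<^sup>2 = l31\<^sup>2 + u3\<^sup>2"
    unfolding m u' using cs(1) by algebra
  moreover have "m32\<^sup>2 + u3''\<^sup>2 = l32\<^sup>2 + u3'\<^sup>2"
    unfolding m u'' using cs'(1) by algebra
  ultimately have gram: "m11 * m21 = l11 * l21 + u1 * u2" "m21\<^sup>2 + m22\<^sup>2 = l21\<^sup>2 + l22\<^sup>2 + u2\<^sup>2"
    "m11 * m31 = l11 * l31 + u1 * u3" "m21 * m31 + m22 * m32 = l21 * l31 + l22 * l32 + u2 * u3"
    "m31\<^sup>2 + m32\<^sup>2 + m33\<^sup>2 = l31\<^sup>2 + l32\<^sup>2 + l33\<^sup>2 + u3\<^sup>2"
    using m33 by simp_all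
  have "(\<integral>\<^sup>+t. \<integral>\<^sup>+x. \<integral>\<^sup>+y. \<integral>\<^sup>+z.
         f (l11 * x + u1 * t, l21 * x + l22 * y + u2 * t, l31 * x + l32 * y + l33 * z + u3 * t)
         \<partial>std_gaussian \<partial>std_gaussian \<partial>std_gaussian \<partial>std_gaussian)
      = (\<integral>\<^sup>+x. \<integral>\<^sup>+y. \<integral>\<^sup>+z. f (m11 * x, m21 * x + m22 * y, m31 * x + m32 * y + m33 * z)
         \<partial>std_gaussian \<partial>std_gaussian \<partial>std_gaussian)"
    if [measurable]: "f \<in> borel_measurable (borel \<Otimes>\<^sub>M borel \<Otimes>\<^sub>M borel)" for f :: "real \<times> real \<times> real \<Rightarrow> ennreal"
  proof -
    let ?N = std_gaussian
    have 1: "l11 * (c * x - s * t) + u1 * (s * x + c * t) = m11 * x"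
         "l21 * (c * x - s * t) + b + u2 * (s * x + c * t) = m21 * x + b + u2' * t"
         "l31 * (c * x - s * t) + b + d + u3 * (s * x + c * t) = m31 * x + b + d + u3' * t" for x t b d
      using cs(4) unfolding m u' by algebra+
    have 2: "a + l22 * (c' * x - s' * t) + u2' * (s' * x + c' * t) = a + m22 * x"
         "a + l32 * (c' * x - s' * t) + d + u3' * (s' * x + c' * t) = a + m32 * x + d + u3'' * t" for x t a d
      using cs'(4) unfolding m u'' by (algebra, simp add: algebra_simps)
    have 3: "a + b + l33 * (c'' * x - s'' * t) + u3'' * (s'' * x + c'' * t) = a + b + m33 * x" for x t a b
      using cs''(4) unfolding m by algebra
    have "(\<integral>\<^sup>+t. \<integral>\<^sup>+x. \<integral>\<^sup>+y. \<integral>\<^sup>+z.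
         f (l11 * x + u1 * t, l21 * x + l22 * y + u2 * t, l31 * x + l32 * y + l33 * z + u3 * t) \<partial>?N \<partial>?N \<partial>?N \<partial>?N)
      = (\<integral>\<^sup>+x. \<integral>\<^sup>+t. \<integral>\<^sup>+y. \<integral>\<^sup>+z.
         f (l11 * x + u1 * t, l21 * x + l22 * y + u2 * t, l31 * x + l32 * y + l33 * z + u3 * t) \<partial>?N \<partial>?N \<partial>?N \<partial>?N)"
      by (rule NN.Fubini') measurable
    also have "\<dots> = (\<integral>\<^sup>+x. \<integral>\<^sup>+t. \<integral>\<^sup>+y. \<integral>\<^sup>+z.
         f (m11 * x, m21 * x + l22 * y + u2' * t, m31 * x + l32 * y + l33 * z + u3' * t) \<partial>?N \<partial>?N \<partial>?N \<partial>?N)"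
      by (rule std_gaussian_rotation[OF cs(1,2), of "\<lambda>x t. \<integral>\<^sup>+y. \<integral>\<^sup>+z.
         f (l11 * x + u1 * t, l21 * x + l22 * y + u2 * t, l31 * x + l32 * y + l33 * z + u3 * t) \<partial>?N \<partial>?N",
         unfolded 1, symmetric]) measurable
    \<comment> \<open>Between rotations the integral over \<open>t\<close> moves one place inward,
      next to the variable it is rotated with.\<close>
    also have "\<dots> = (\<integral>\<^sup>+x. \<integral>\<^sup>+y. \<integral>\<^sup>+t. \<integral>\<^sup>+z.
         f (m11 * x, m21 * x + l22 * y + u2' * t, m31 * x + l32 * y + l33 * z + u3' * t) \<partial>?N \<partial>?N \<partial>?N \<partial>?N)"
      by (intro nn_integral_cong NN.Fubini') measurable
    also have "\<dots> = (\<integral>\<^sup>+x. \<integral>\<^sup>+y. \<integral>\<^sup>+t. \<integral>\<^sup>+z.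
         f (m11 * x, m21 * x + m22 * y, m31 * x + m32 * y + l33 * z + u3'' * t) \<partial>?N \<partial>?N \<partial>?N \<partial>?N)"
    proof (rule nn_integral_cong)
      fix x
      show "(\<integral>\<^sup>+y. \<integral>\<^sup>+t. \<integral>\<^sup>+z.
         f (m11 * x, m21 * x + l22 * y + u2' * t, m31 * x + l32 * y + l33 * z + u3' * t) \<partial>?N \<partial>?N \<partial>?N)
        = (\<integral>\<^sup>+y. \<integral>\<^sup>+t. \<integral>\<^sup>+z.
         f (m11 * x, m21 * x + m22 * y, m31 * x + m32 * y + l33 * z + u3'' * t) \<partial>?N \<partial>?N \<partial>?N)"
        by (rule std_gaussian_rotation[OF cs'(1,2), of "\<lambda>y t. \<integral>\<^sup>+z.
          f (m11 * x, m21 * x + l22 * y + u2' * t, m31 * x + l32 * y + l33 * z + u3' * t) \<partial>?N",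
          unfolded 2, symmetric]) measurable
    qed
    also have "\<dots> = (\<integral>\<^sup>+x. \<integral>\<^sup>+y. \<integral>\<^sup>+z. \<integral>\<^sup>+t.
         f (m11 * x, m21 * x + m22 * y, m31 * x + m32 * y + l33 * z + u3'' * t) \<partial>?N \<partial>?N \<partial>?N \<partial>?N)"
      by (intro nn_integral_cong NN.Fubini') measurable
    also have "\<dots> = (\<integral>\<^sup>+x. \<integral>\<^sup>+y. \<integral>\<^sup>+z. \<integral>\<^sup>+t.
         f (m11 * x, m21 * x + m22 * y, m31 * x + m32 * y + m33 * z) \<partial>?N \<partial>?N \<partial>?N \<partial>?N)"
    proof (rule nn_integral_cong, rule nn_integral_cong)
      fix x y
      show "(\<integral>\<^sup>+z. \<integral>\<^sup>+t.
         f (m11 * x, m21 * x + m22 * y, m31 * x + m32 * y + l33 * z + u3'' * t) \<partial>?N \<partial>?N)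
        = (\<integral>\<^sup>+z. \<integral>\<^sup>+t.
         f (m11 * x, m21 * x + m22 * y, m31 * x + m32 * y + m33 * z) \<partial>?N \<partial>?N)"
        by (rule std_gaussian_rotation[OF cs''(1,2), of "\<lambda>z t.
          f (m11 * x, m21 * x + m22 * y, m31 * x + m32 * y + l33 * z + u3'' * t)",
          unfolded 3, symmetric]) measurable
    qed
    \<comment> \<open>By now the integrand is free of \<open>t\<close>, whose integral contributes
      the total mass 1.\<close>
    also have "\<dots> = (\<integral>\<^sup>+x. \<integral>\<^sup>+y. \<integral>\<^sup>+z.
         f (m11 * x, m21 * x + m22 * y, m31 * x + m32 * y + m33 * z) \<partial>?N \<partial>?N \<partial>?N)"
      by (simp add: std_gaussian.emeasure_space_1[simplified])
    finally show ?thesis .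
  qed
  then show ?thesis using m11 m22(1) m33(1) gram by blast
qed

text \<open>Induction over the coordinates, each absorbed by a rank-one update. Describing the
  triangular factor by its Gram equations covers degenerate families too, beginning with the zero
  factor for the empty index set.\<close>

lemma std_gaussian_triangular:
  fixes v1 v2 v3 :: "'i \<Rightarrow> real"
  assumes "finite J"
  shows "\<exists>l11 l21 l22 l31 l32 l33. l11 \<ge> 0 \<and> l22 \<ge> 0 \<and> l33 \<ge> 0 \<and>
    l11\<^sup>2 = (\<Sum>j\<in>J. (v1 j)\<^sup>2) \<and> l11 * l21 = (\<Sum>j\<in>J. v1 j * v2 j) \<and>
    l21\<^sup>2 + l22\<^sup>2 = (\<Sum>j\<in>J. (v2 j)\<^sup>2) \<and> l11 * l31 = (\<Sum>j\<in>J. v1 j * v3 j) \<and>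
    l21 * l31 + l22 * l32 = (\<Sum>j\<in>J. v2 j * v3 j) \<and>
    l31\<^sup>2 + l32\<^sup>2 + l33\<^sup>2 = (\<Sum>j\<in>J. (v3 j)\<^sup>2) \<and>
    (\<forall>f \<in> borel_measurable (borel \<Otimes>\<^sub>M borel \<Otimes>\<^sub>M borel).
      (\<integral>\<^sup>+w. f (\<Sum>j\<in>J. v1 j * w j, \<Sum>j\<in>J. v2 j * w j, \<Sum>j\<in>J. v3 j * w j) \<partial>Pi\<^sub>M J (\<lambda>_. std_gaussian))
      = (\<integral>\<^sup>+x. \<integral>\<^sup>+y. \<integral>\<^sup>+z. (f (l11 * x, l21 * x + l22 * y, l31 * x + l32 * y + l33 * z) :: ennreal)
         \<partial>std_gaussian \<partial>std_gaussian \<partial>std_gaussian))"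
  using assms
proof (induction J rule: finite_induct)
  case empty
  show ?case
    by (rule exI[of _ 0])+ (simp add: PiM_empty nn_integral_count_space_finite std_gaussian.emeasure_space_1[simplified])
next
  case (insert i J)
  interpret product_sigma_finite "\<lambda>_. std_gaussian" ..
  from insert.IH obtain l11 l21 l22 l31 l32 l33 where l: "l11 \<ge> 0" "l22 \<ge> 0" "l33 \<ge> 0"
    and gram: "l11\<^sup>2 = (\<Sum>j\<in>J. (v1 j)\<^sup>2)" "l11 * l21 = (\<Sum>j\<in>J. v1 j * v2 j)"
    "l21\<^sup>2 + l22\<^sup>2 = (\<Sum>j\<in>J. (v2 j)\<^sup>2)" "l11 * l31 = (\<Sum>j\<in>J. v1 j * v3 j)"
    "l21 * l31 + l22 * l32 = (\<Sum>j\<in>J. v2 j * v3 j)"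
    "l31\<^sup>2 + l32\<^sup>2 + l33\<^sup>2 = (\<Sum>j\<in>J. (v3 j)\<^sup>2)"
    and law: "\<And>f :: _ \<Rightarrow> ennreal. f \<in> borel_measurable (borel \<Otimes>\<^sub>M borel \<Otimes>\<^sub>M borel) \<Longrightarrow>
      (\<integral>\<^sup>+w. f (\<Sum>j\<in>J. v1 j * w j, \<Sum>j\<in>J. v2 j * w j, \<Sum>j\<in>J. v3 j * w j) \<partial>Pi\<^sub>M J (\<lambda>_. std_gaussian))
      = (\<integral>\<^sup>+x. \<integral>\<^sup>+y. \<integral>\<^sup>+z. f (l11 * x, l21 * x + l22 * y, l31 * x + l32 * y + l33 * z)
         \<partial>std_gaussian \<partial>std_gaussian \<partial>std_gaussian)"
    by blast
  have eq: "(\<integral>\<^sup>+w. f (\<Sum>j\<in>insert i J. v1 j * w j, \<Sum>j\<in>insert i J. v2 j * w j, \<Sum>j\<in>insert i J. v3 j * w j)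
        \<partial>Pi\<^sub>M (insert i J) (\<lambda>_. std_gaussian))
      = (\<integral>\<^sup>+t. \<integral>\<^sup>+x. \<integral>\<^sup>+y. \<integral>\<^sup>+z.
         f (l11 * x + v1 i * t, l21 * x + l22 * y + v2 i * t, l31 * x + l32 * y + l33 * z + v3 i * t)
         \<partial>std_gaussian \<partial>std_gaussian \<partial>std_gaussian \<partial>std_gaussian)"
    if [measurable]: "f \<in> borel_measurable (borel \<Otimes>\<^sub>M borel \<Otimes>\<^sub>M borel)" for f :: "_ \<Rightarrow> ennreal"
  proof -
    have sum_eq: "(\<Sum>j\<in>J. v j * (w(i := t)) j) = (\<Sum>j\<in>J. v j * w j)" for v w and t :: real
      using insert.hyps by (intro sum.cong) auto
    have "(\<integral>\<^sup>+w. f (\<Sum>j\<in>insert i J. v1 j * w j, \<Sum>j\<in>insert i J. v2 j * w j, \<Sum>j\<in>insert i J. v3 j * w j)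
        \<partial>Pi\<^sub>M (insert i J) (\<lambda>_. std_gaussian))
      = (\<integral>\<^sup>+t. \<integral>\<^sup>+w. f ((\<Sum>j\<in>J. v1 j * w j) + v1 i * t, (\<Sum>j\<in>J. v2 j * w j) + v2 i * t, (\<Sum>j\<in>J. v3 j * w j) + v3 i * t)
          \<partial>Pi\<^sub>M J (\<lambda>_. std_gaussian) \<partial>std_gaussian)"
      using insert.hyps
      by (subst product_nn_integral_insert_rev)
         (simp_all add: sum_eq sum.insert add.commute fun_upd_same del: fun_upd_apply)
    also have "\<dots> = (\<integral>\<^sup>+t. \<integral>\<^sup>+x. \<integral>\<^sup>+y. \<integral>\<^sup>+z.
         f (l11 * x + v1 i * t, l21 * x + l22 * y + v2 i * t, l31 * x + l32 * y + l33 * z + v3 i * t)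
         \<partial>std_gaussian \<partial>std_gaussian \<partial>std_gaussian \<partial>std_gaussian)"
    proof (rule nn_integral_cong)
      fix t
      show "(\<integral>\<^sup>+w. f ((\<Sum>j\<in>J. v1 j * w j) + v1 i * t, (\<Sum>j\<in>J. v2 j * w j) + v2 i * t, (\<Sum>j\<in>J. v3 j * w j) + v3 i * t)
          \<partial>Pi\<^sub>M J (\<lambda>_. std_gaussian)) = (\<integral>\<^sup>+x. \<integral>\<^sup>+y. \<integral>\<^sup>+z.
         f (l11 * x + v1 i * t, l21 * x + l22 * y + v2 i * t, l31 * x + l32 * y + l33 * z + v3 i * t)
         \<partial>std_gaussian \<partial>std_gaussian \<partial>std_gaussian)"
        using law[of "\<lambda>(a, b, c). f (a + v1 i * t, b + v2 i * t, c + v3 i * t)"] by simp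
    qed
    finally show ?thesis .
  qed
  from std_gaussian_triangular_absorb[OF l, of "v1 i" l21 "v2 i" l31 "v3 i" l32]
  show ?case
    using insert.hyps eq gram
    apply (elim exE)
    subgoal for m11 m21 m22 m31 m32 m33
      by (rule exI[of _ m11], rule exI[of _ m21], rule exI[of _ m22], rule exI[of _ m31],
          rule exI[of _ m32], rule exI[of _ m33]) (simp add: add_ac)
    done
qed

text \<open>Positive definiteness of the leading minors makes the triangular factor of the Gram matrix unique.\<close>

lemma std_gaussian_law_of_gram:
  fixes v1 v2 v3 :: "'i \<Rightarrow> real" and w1 w2 w3 :: "'k \<Rightarrow> real"
  assumes J: "finite J" and K: "finite K"
    and gram: "(\<Sum>j\<in>J. (v1 j)\<^sup>2) = (\<Sum>k\<in>K. (w1 k)\<^sup>2)" "(\<Sum>j\<in>J. v1 j * v2 j) = (\<Sum>k\<in>K. w1 k * w2 k)"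
      "(\<Sum>j\<in>J. (v2 j)\<^sup>2) = (\<Sum>k\<in>K. (w2 k)\<^sup>2)" "(\<Sum>j\<in>J. v1 j * v3 j) = (\<Sum>k\<in>K. w1 k * w3 k)"
      "(\<Sum>j\<in>J. v2 j * v3 j) = (\<Sum>k\<in>K. w2 k * w3 k)" "(\<Sum>j\<in>J. (v3 j)\<^sup>2) = (\<Sum>k\<in>K. (w3 k)\<^sup>2)"
    and pos: "(\<Sum>k\<in>K. (w1 k)\<^sup>2) > 0"
      "(\<Sum>k\<in>K. w1 k * w2 k)\<^sup>2 < (\<Sum>k\<in>K. (w1 k)\<^sup>2) * (\<Sum>k\<in>K. (w2 k)\<^sup>2)"
    and f: "f \<in> borel_measurable (borel \<Otimes>\<^sub>M borel \<Otimes>\<^sub>M borel)"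
  shows "(\<integral>\<^sup>+w. f (\<Sum>j\<in>J. v1 j * w j, \<Sum>j\<in>J. v2 j * w j, \<Sum>j\<in>J. v3 j * w j) \<partial>Pi\<^sub>M J (\<lambda>_. std_gaussian))
    = (\<integral>\<^sup>+w. (f (\<Sum>k\<in>K. w1 k * w k, \<Sum>k\<in>K. w2 k * w k, \<Sum>k\<in>K. w3 k * w k) :: ennreal)
        \<partial>Pi\<^sub>M K (\<lambda>_. std_gaussian))"
proof -
  from std_gaussian_triangular[OF J, of v1 v2 v3]
  obtain l11 l21 l22 l31 l32 l33 where l: "l11 \<ge> 0" "l22 \<ge> 0" "l33 \<ge> 0"
    "l11\<^sup>2 = (\<Sum>j\<in>J. (v1 j)\<^sup>2)" "l11 * l21 = (\<Sum>j\<in>J. v1 j * v2 j)"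
    "l21\<^sup>2 + l22\<^sup>2 = (\<Sum>j\<in>J. (v2 j)\<^sup>2)" "l11 * l31 = (\<Sum>j\<in>J. v1 j * v3 j)"
    "l21 * l31 + l22 * l32 = (\<Sum>j\<in>J. v2 j * v3 j)"
    "l31\<^sup>2 + l32\<^sup>2 + l33\<^sup>2 = (\<Sum>j\<in>J. (v3 j)\<^sup>2)"
    and law: "(\<integral>\<^sup>+w. f (\<Sum>j\<in>J. v1 j * w j, \<Sum>j\<in>J. v2 j * w j, \<Sum>j\<in>J. v3 j * w j) \<partial>Pi\<^sub>M J (\<lambda>_. std_gaussian))
      = (\<integral>\<^sup>+x. \<integral>\<^sup>+y. \<integral>\<^sup>+z. f (l11 * x, l21 * x + l22 * y, l31 * x + l32 * y + l33 * z)
         \<partial>std_gaussian \<partial>std_gaussian \<partial>std_gaussian)"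
    using f by blast
  from std_gaussian_triangular[OF K, of w1 w2 w3]
  obtain m11 m21 m22 m31 m32 m33 where m: "m11 \<ge> 0" "m22 \<ge> 0" "m33 \<ge> 0"
    "m11\<^sup>2 = (\<Sum>k\<in>K. (w1 k)\<^sup>2)" "m11 * m21 = (\<Sum>k\<in>K. w1 k * w2 k)"
    "m21\<^sup>2 + m22\<^sup>2 = (\<Sum>k\<in>K. (w2 k)\<^sup>2)" "m11 * m31 = (\<Sum>k\<in>K. w1 k * w3 k)"
    "m21 * m31 + m22 * m32 = (\<Sum>k\<in>K. w2 k * w3 k)"
    "m31\<^sup>2 + m32\<^sup>2 + m33\<^sup>2 = (\<Sum>k\<in>K. (w3 k)\<^sup>2)"
    and law': "(\<integral>\<^sup>+w. f (\<Sum>k\<in>K. w1 k * w k, \<Sum>k\<in>K. w2 k * w k, \<Sum>k\<in>K. w3 k * w k) \<partial>Pi\<^sub>M K (\<lambda>_. std_gaussian))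
      = (\<integral>\<^sup>+x. \<integral>\<^sup>+y. \<integral>\<^sup>+z. f (m11 * x, m21 * x + m22 * y, m31 * x + m32 * y + m33 * z)
         \<partial>std_gaussian \<partial>std_gaussian \<partial>std_gaussian)"
    using f by blast
  have "l11 = m11"
    using l(1,4) m(1,4) gram(1) by (metis power2_eq_imp_eq)
  have "m11 \<noteq> 0"
    using m(4) pos(1) by auto
  then have 1: "l21 = m21" "l31 = m31"
    using l(5,7) m(5,7) gram(2,4) \<open>l11 = m11\<close> by (metis mult_left_cancel)+
  have "l22\<^sup>2 = m22\<^sup>2"
    using l(6) m(6) gram(3) 1 by simp
  then have "l22 = m22"
    using l(2) m(2) by (metis power2_eq_imp_eq)
  have "m11\<^sup>2 * m22\<^sup>2 > 0"
    using pos(2) unfolding m(4-6)[symmetric] by (simp add: algebra_simps power_mult_distrib)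
  then have "m22 \<noteq> 0" by auto
  then have "l32 = m32"
    using l(8) m(8) gram(5) 1 \<open>l22 = m22\<close> by (metis add_left_cancel mult_left_cancel)
  have "l33\<^sup>2 = m33\<^sup>2"
    using l(9) m(9) gram(6) 1 \<open>l32 = m32\<close> by simp
  then have "l33 = m33"
    using l(3) m(3) by (metis power2_eq_imp_eq)
  show ?thesis
    unfolding law law' using 1 \<open>l11 = m11\<close> \<open>l22 = m22\<close> \<open>l32 = m32\<close> \<open>l33 = m33\<close> by simp
qed

section \<open>Reduction to a single loading\<close>

text \<open>The conditional probability that a one-factor variable with loading \<open>l\<close>
  lies in \<open>[-1, 1]\<close>, given the value \<open>g\<close> of the common factor.\<close>

definition slab :: "real \<Rightarrow> real \<Rightarrow> real" where
  "slab l g = measure std_gaussian {z. \<bar>l * g + sqrt (1 - l\<^sup>2) * z\<bar> \<le> 1}"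

lemma slab_nonneg [simp]: "0 \<le> slab l g" and slab_le_1 [simp]: "slab l g \<le> 1"
  by (simp_all add: slab_def)

lemma slab_ennreal: "ennreal (slab l g) = (\<integral>\<^sup>+z. indicator {..1} \<bar>l * g + sqrt (1 - l\<^sup>2) * z\<bar> \<partial>std_gaussian)"
proof -
  have "(\<integral>\<^sup>+z. indicator {..1} \<bar>l * g + sqrt (1 - l\<^sup>2) * z\<bar> \<partial>std_gaussian)
      = (\<integral>\<^sup>+z. indicator {z. \<bar>l * g + sqrt (1 - l\<^sup>2) * z\<bar> \<le> 1} z \<partial>std_gaussian)"
    by (intro nn_integral_cong) (simp add: indicator_def)
  also have "\<dots> = emeasure std_gaussian {z. \<bar>l * g + sqrt (1 - l\<^sup>2) * z\<bar> \<le> 1}"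
    by (rule nn_integral_indicator) simp
  finally show ?thesis
    by (simp add: slab_def std_gaussian.emeasure_eq_measure)
qed

lemma borel_measurable_slab [measurable]: "slab l \<in> borel_measurable borel"
proof -
  have "(\<lambda>g. \<integral>\<^sup>+z. indicator {..1} \<bar>l * g + sqrt (1 - l\<^sup>2) * z\<bar> \<partial>std_gaussian) \<in> borel_measurable borel"
    by measurable
  then have "(\<lambda>g. enn2real (ennreal (slab l g))) \<in> borel_measurable borel"
    unfolding slab_ennreal by measurable
  then show ?thesis by simp
qed

lemma integrable_slab_power [simp]: "integrable std_gaussian (\<lambda>g. slab l g ^ k)"
  by (rule std_gaussian.integrable_const_bound[where B=1]) (auto simp: power_le_one)

section \<open>One-factor representation of the three constraints\<close>

lemma nn_integral_PiM_4:
  fixes f :: "real \<times> real \<times> real \<times> real \<Rightarrow> ennreal"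
  assumes [measurable]: "f \<in> borel_measurable (borel \<Otimes>\<^sub>M borel \<Otimes>\<^sub>M borel \<Otimes>\<^sub>M borel)"
  shows "(\<integral>\<^sup>+w. f (w 0, w 1, w 2, w 3) \<partial>Pi\<^sub>M {0, 1, 2, 3 :: nat} (\<lambda>_. std_gaussian))
    = (\<integral>\<^sup>+a. \<integral>\<^sup>+b. \<integral>\<^sup>+c. \<integral>\<^sup>+d. f (a, b, c, d) \<partial>std_gaussian \<partial>std_gaussian \<partial>std_gaussian \<partial>std_gaussian)"
proof -
  interpret product_sigma_finite "\<lambda>_::nat. std_gaussian" ..
  let ?P = "\<lambda>I :: nat set. Pi\<^sub>M I (\<lambda>_. std_gaussian)"
  have "(\<integral>\<^sup>+w. f (w 0, w 1, w 2, w 3) \<partial>?P {0, 1, 2, 3})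
      = (\<integral>\<^sup>+a. \<integral>\<^sup>+w. f (a, w 1, w 2, w 3) \<partial>?P {1, 2, 3} \<partial>std_gaussian)"
    by (subst product_nn_integral_insert_rev) simp_all
  also have "\<dots> = (\<integral>\<^sup>+a. \<integral>\<^sup>+b. \<integral>\<^sup>+w. f (a, b, w 2, w 3) \<partial>?P {2, 3} \<partial>std_gaussian \<partial>std_gaussian)"
    by (intro nn_integral_cong, subst product_nn_integral_insert_rev) simp_all
  also have "\<dots> = (\<integral>\<^sup>+a. \<integral>\<^sup>+b. \<integral>\<^sup>+c. \<integral>\<^sup>+w. f (a, b, c, w 3) \<partial>?P {3} \<partial>std_gaussian \<partial>std_gaussian \<partial>std_gaussian)"
    by (intro nn_integral_cong, subst product_nn_integral_insert_rev) simp_all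
  also have "\<dots> = (\<integral>\<^sup>+a. \<integral>\<^sup>+b. \<integral>\<^sup>+c. \<integral>\<^sup>+d. f (a, b, c, d) \<partial>std_gaussian \<partial>std_gaussian \<partial>std_gaussian \<partial>std_gaussian)"
    by (intro nn_integral_cong, subst product_nn_integral_singleton) simp_all
  finally show ?thesis .
qed

text \<open>The law depends on the Gram matrix only, and this one is also the Gram matrix of a
  common factor plus private noises. Given the factor, the three constraints are
  independent.\<close>

lemma one_factor_prob:
  fixes v1 v2 v3 :: "'i \<Rightarrow> real"
  assumes J: "finite J" and l: "\<bar>l1\<bar> < 1" "\<bar>l2\<bar> < 1" "\<bar>l3\<bar> < 1"
    and gram: "(\<Sum>j\<in>J. (v1 j)\<^sup>2) = 1" "(\<Sum>j\<in>J. (v2 j)\<^sup>2) = 1" "(\<Sum>j\<in>J. (v3 j)\<^sup>2) = 1"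
      "(\<Sum>j\<in>J. v1 j * v2 j) = l1 * l2" "(\<Sum>j\<in>J. v1 j * v3 j) = l1 * l3" "(\<Sum>j\<in>J. v2 j * v3 j) = l2 * l3"
  defines "P \<equiv> Pi\<^sub>M J (\<lambda>_. std_gaussian)"
  shows "measure P {w \<in> space P. \<bar>\<Sum>j\<in>J. v1 j * w j\<bar> \<le> 1 \<and> \<bar>\<Sum>j\<in>J. v2 j * w j\<bar> \<le> 1 \<and> \<bar>\<Sum>j\<in>J. v3 j * w j\<bar> \<le> 1}
    = (\<integral>g. slab l1 g * slab l2 g * slab l3 g \<partial>std_gaussian)"
proof -
  interpret P: prob_space P
    unfolding P_def by (rule prob_space_PiM) (rule std_gaussian.prob_space_axioms)
  define K :: "nat set" where "K = {0, 1, 2, 3}"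
  \<comment> \<open>Coefficients of the one-factor form: index 0 is the common factor, index
    \<open>i\<close> the noise private to the \<open>i\<close>-th variable.\<close>
  define w where "w i l k = (if k = 0 then l else if k = i then sqrt (1 - l\<^sup>2) else 0)" for i k :: nat and l :: real
  let ?i = "indicator {..1} :: real \<Rightarrow> ennreal"
  define f :: "real \<times> real \<times> real \<Rightarrow> ennreal" where "f = (\<lambda>(x, y, z). ?i \<bar>x\<bar> * ?i \<bar>y\<bar> * ?i \<bar>z\<bar>)"
  have f [measurable]: "f \<in> borel_measurable (borel \<Otimes>\<^sub>M borel \<Otimes>\<^sub>M borel)"
    unfolding f_def by measurable
  have l2: "l1\<^sup>2 < 1" "l2\<^sup>2 < 1" "l3\<^sup>2 < 1"
    using l by (simp_all add: abs_square_less_1)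
  have sq: "(\<Sum>k\<in>K. (w i l k)\<^sup>2) = 1" if "i \<in> {1, 2, 3}" "l\<^sup>2 < 1" for i l
    using that by (auto simp: K_def w_def)
  have prod: "(\<Sum>k\<in>K. w i l k * w i' l' k) = l * l'" if "i \<in> {1, 2, 3}" "i' \<in> {1, 2, 3}" "i \<noteq> i'" for i i' l l'
    using that by (auto simp: K_def w_def)
  have lin: "(\<Sum>k\<in>K. w i l k * x k) = l * x 0 + sqrt (1 - l\<^sup>2) * x i" if "i \<in> {1, 2, 3}" for i l x
    using that by (auto simp: K_def w_def)
  have "emeasure P {w \<in> space P. \<bar>\<Sum>j\<in>J. v1 j * w j\<bar> \<le> 1 \<and> \<bar>\<Sum>j\<in>J. v2 j * w j\<bar> \<le> 1 \<and> \<bar>\<Sum>j\<in>J. v3 j * w j\<bar> \<le> 1}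
      = (\<integral>\<^sup>+w. f (\<Sum>j\<in>J. v1 j * w j, \<Sum>j\<in>J. v2 j * w j, \<Sum>j\<in>J. v3 j * w j) \<partial>P)"
  proof (subst nn_integral_indicator[symmetric])
    show "{w \<in> space P. \<bar>\<Sum>j\<in>J. v1 j * w j\<bar> \<le> 1 \<and> \<bar>\<Sum>j\<in>J. v2 j * w j\<bar> \<le> 1 \<and> \<bar>\<Sum>j\<in>J. v3 j * w j\<bar> \<le> 1} \<in> sets P"
      unfolding P_def by measurable
  qed (auto simp: f_def indicator_def intro!: nn_integral_cong)
  also have "\<dots> = (\<integral>\<^sup>+x. f (\<Sum>k\<in>K. w 1 l1 k * x k, \<Sum>k\<in>K. w 2 l2 k * x k, \<Sum>k\<in>K. w 3 l3 k * x k)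
      \<partial>Pi\<^sub>M K (\<lambda>_. std_gaussian))"
    unfolding P_def
  proof (rule std_gaussian_law_of_gram[OF J])
    \<comment> \<open>Positivity of the second leading minor, as demanded for uniqueness of the
      triangular factor.\<close>
    have "(l1 * l2)\<^sup>2 < 1"
      using l by (simp add: abs_square_less_1 abs_mult mult_le_one)
        (metis abs_ge_zero mult_strict_mono' mult.right_neutral)
    then show "(\<Sum>k\<in>K. w 1 l1 k * w 2 l2 k)\<^sup>2 < (\<Sum>k\<in>K. (w 1 l1 k)\<^sup>2) * (\<Sum>k\<in>K. (w 2 l2 k)\<^sup>2)"
      using l2 by (simp add: sq prod)
  qed (use l2 in \<open>simp_all add: sq prod gram f\<close>, simp add: K_def)
  also have "\<dots> = (\<integral>\<^sup>+g. \<integral>\<^sup>+a. \<integral>\<^sup>+b. \<integral>\<^sup>+c.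
      f (l1 * g + sqrt (1 - l1\<^sup>2) * a, l2 * g + sqrt (1 - l2\<^sup>2) * b, l3 * g + sqrt (1 - l3\<^sup>2) * c)
      \<partial>std_gaussian \<partial>std_gaussian \<partial>std_gaussian \<partial>std_gaussian)"
    using nn_integral_PiM_4[of "\<lambda>(g, a, b, c).
      f (l1 * g + sqrt (1 - l1\<^sup>2) * a, l2 * g + sqrt (1 - l2\<^sup>2) * b, l3 * g + sqrt (1 - l3\<^sup>2) * c)"]
    by (simp add: lin) (simp add: K_def)
  also have "\<dots> = (\<integral>\<^sup>+g. ennreal (slab l1 g) * ennreal (slab l2 g) * ennreal (slab l3 g) \<partial>std_gaussian)"
    unfolding f_def by (simp add: nn_integral_cmult nn_integral_multc slab_ennreal)
  also have "\<dots> = (\<integral>\<^sup>+g. ennreal (slab l1 g * slab l2 g * slab l3 g) \<partial>std_gaussian)"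
    by (simp add: ennreal_mult)
  also have "\<dots> = ennreal (\<integral>g. slab l1 g * slab l2 g * slab l3 g \<partial>std_gaussian)"
    by (rule nn_integral_eq_integral)
       (auto intro!: std_gaussian.integrable_const_bound[where B=1] AE_I2 mult_le_one)
  finally show ?thesis
    by (simp add: P.emeasure_eq_measure)
qed

text \<open>Jensen's inequality for the cube, from the tangent at the mean \<open>m\<close>: for
  nonnegative values the gap factors as \<open>(X x - m)\<^sup>2 * (X x + 2 * m)\<close>.\<close>

lemma cube_integral_le:
  assumes [measurable]: "X \<in> borel_measurable std_gaussian" and X: "\<And>x. 0 \<le> X x" "\<And>x. X x \<le> (1::real)"
  shows "(\<integral>x. X x \<partial>std_gaussian) ^ 3 \<le> (\<integral>x. X x ^ 3 \<partial>std_gaussian)"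
proof -
  have int [simp]: "integrable std_gaussian (\<lambda>x. X x ^ k)" for k
    by (rule std_gaussian.integrable_const_bound[where B=1]) (auto simp: power_le_one X)
  note int[of 1, simplified, simp]
  define m where "m = (\<integral>x. X x \<partial>std_gaussian)"
  have m: "m \<ge> 0"
    unfolding m_def using X by simp
  have "(\<integral>x. 3 * m\<^sup>2 * X x - 2 * m ^ 3 \<partial>std_gaussian) \<le> (\<integral>x. X x ^ 3 \<partial>std_gaussian)"
  proof (rule integral_mono)
    fix x
    have "0 \<le> (X x - m)\<^sup>2 * (X x + 2 * m)"
      using X m by simp
    also have "\<dots> = X x ^ 3 - (3 * m\<^sup>2 * X x - 2 * m ^ 3)"
      by algebra
    finally show "3 * m\<^sup>2 * X x - 2 * m ^ 3 \<le> X x ^ 3" by simp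
  qed auto
  also have "(\<integral>x. 3 * m\<^sup>2 * X x - 2 * m ^ 3 \<partial>std_gaussian) = 3 * m\<^sup>2 * m - 2 * m ^ 3"
    by (subst Bochner_Integration.integral_diff)
       (auto simp: m_def[symmetric] std_gaussian.prob_space[simplified])
  also have "\<dots> = m ^ 3" by algebra
  finally show ?thesis by (simp add: m_def)
qed

text \<open>Loading \<open>l\<close> arises from loading \<open>m\<close> by making the common
  factor noisy: \<open>m\<close> times the mixture of \<open>g\<close> and \<open>h\<close> is
  \<open>l * g\<close> plus a multiple of \<open>h\<close>, and this extra noise together with that
  of \<open>slab m\<close> has variance \<open>1 - l\<^sup>2\<close>. One rotation merges the two
  noises.\<close>

lemma slab_smoothing:
  assumes lm: "0 \<le> l" "l \<le> m" "m < 1" "0 < m"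
  shows "slab l g = (\<integral>h. slab m (l / m * g + sqrt (1 - (l / m)\<^sup>2) * h) \<partial>std_gaussian)"
proof -
  let ?c = "l / m" and ?s = "sqrt (1 - (l / m)\<^sup>2)" and ?i = "indicator {..1} :: real \<Rightarrow> ennreal"
  have c1: "?c\<^sup>2 \<le> 1"
    using lm by (intro power_le_one) auto
  have m1: "m\<^sup>2 \<le> 1"
    using lm by (intro power_le_one) auto
  obtain c s where cs: "c\<^sup>2 + s\<^sup>2 = 1" "c \<ge> 0"
    "c * sqrt (1 - m\<^sup>2) + s * (m * ?s) = sqrt ((sqrt (1 - m\<^sup>2))\<^sup>2 + (m * ?s)\<^sup>2)"
    "c * (m * ?s) = s * sqrt (1 - m\<^sup>2)"
    using givens_coefficients[of "sqrt (1 - m\<^sup>2)" "m * ?s"] m1 by auto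
  have "(sqrt (1 - m\<^sup>2))\<^sup>2 + (m * ?s)\<^sup>2 = 1 - m\<^sup>2 + m\<^sup>2 * (1 - ?c\<^sup>2)"
    using c1 m1 by (simp add: power_mult_distrib)
  also have "\<dots> = 1 - l\<^sup>2"
    using lm by (simp add: field_simps)
  finally have r: "c * sqrt (1 - m\<^sup>2) + s * (m * ?s) = sqrt (1 - l\<^sup>2)"
    using cs(3) by simp
  have rot: "l * g + sqrt (1 - m\<^sup>2) * (c * z - s * h) + m * ?s * (s * z + c * h) = l * g + sqrt (1 - l\<^sup>2) * z" for z h
    using cs(4) unfolding r[symmetric] by algebra
  interpret NN: pair_sigma_finite std_gaussian std_gaussian ..
  have "ennreal (slab l g) = (\<integral>\<^sup>+z. \<integral>\<^sup>+h. ?i \<bar>l * g + sqrt (1 - l\<^sup>2) * z\<bar> \<partial>std_gaussian \<partial>std_gaussian)"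
    by (simp add: slab_ennreal std_gaussian.emeasure_space_1[simplified])
  also have "\<dots> = (\<integral>\<^sup>+z. \<integral>\<^sup>+h. ?i \<bar>l * g + sqrt (1 - m\<^sup>2) * z + m * ?s * h\<bar> \<partial>std_gaussian \<partial>std_gaussian)"
    by (rule std_gaussian_rotation[OF cs(1,2), of "\<lambda>z h. ?i \<bar>l * g + sqrt (1 - m\<^sup>2) * z + m * ?s * h\<bar>", unfolded rot])
       measurable
  also have "\<dots> = (\<integral>\<^sup>+h. \<integral>\<^sup>+z. ?i \<bar>l * g + sqrt (1 - m\<^sup>2) * z + m * ?s * h\<bar> \<partial>std_gaussian \<partial>std_gaussian)"
    by (rule NN.Fubini') measurable
  also have "\<dots> = (\<integral>\<^sup>+h. ennreal (slab m (?c * g + ?s * h)) \<partial>std_gaussian)"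
    unfolding slab_ennreal using lm by (simp add: algebra_simps)
  also have "\<dots> = ennreal (\<integral>h. slab m (?c * g + ?s * h) \<partial>std_gaussian)"
    by (rule nn_integral_eq_integral) (auto intro!: std_gaussian.integrable_const_bound[where B=1])
  finally show ?thesis
    by (subst (asm) ennreal_inj) (auto intro!: integral_nonneg)
qed

text \<open>Jensen's inequality is applied to the smoothing average, pointwise in \<open>g\<close>.
  Afterwards the argument of \<open>slab m\<close> is one coordinate of a rotated Gaussian pair,
  hence again standard normal.\<close>

lemma slab_cube_mono:
  assumes lm: "0 \<le> l" "l \<le> m" "m < 1" "0 < m"
  shows "(\<integral>g. slab l g ^ 3 \<partial>std_gaussian) \<le> (\<integral>g. slab m g ^ 3 \<partial>std_gaussian)"
proof -
  let ?c = "l / m" and ?s = "sqrt (1 - (l / m)\<^sup>2)"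
  have c1: "?c\<^sup>2 \<le> 1" "?c \<ge> 0"
    using lm by (auto intro!: power_le_one)
  \<comment> \<open>The minus sign matches the first coordinate \<open>c * x - s * y\<close> in
    \<open>std_gaussian_rotation\<close>.\<close>
  have cs: "?c\<^sup>2 + (-?s)\<^sup>2 = 1"
    using c1 by simp
  have "ennreal (\<integral>g. slab l g ^ 3 \<partial>std_gaussian) = (\<integral>\<^sup>+g. ennreal (slab l g ^ 3) \<partial>std_gaussian)"
    by (rule nn_integral_eq_integral[symmetric]) auto
  also have "\<dots> \<le> (\<integral>\<^sup>+g. (\<integral>\<^sup>+h. ennreal (slab m (?c * g - (-?s) * h) ^ 3) \<partial>std_gaussian) \<partial>std_gaussian)"
  proof (rule nn_integral_mono)
    fix g
    have "slab l g ^ 3 \<le> (\<integral>h. slab m (?c * g + ?s * h) ^ 3 \<partial>std_gaussian)"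
      unfolding slab_smoothing[OF lm] by (rule cube_integral_le) auto
    then have "ennreal (slab l g ^ 3) \<le> ennreal (\<integral>h. slab m (?c * g + ?s * h) ^ 3 \<partial>std_gaussian)"
      by (rule ennreal_leI)
    also have "\<dots> = (\<integral>\<^sup>+h. ennreal (slab m (?c * g + ?s * h) ^ 3) \<partial>std_gaussian)"
      by (rule nn_integral_eq_integral[symmetric])
         (auto intro!: std_gaussian.integrable_const_bound[where B=1] AE_I2 power_le_one)
    finally show "ennreal (slab l g ^ 3) \<le> (\<integral>\<^sup>+h. ennreal (slab m (?c * g - (-?s) * h) ^ 3) \<partial>std_gaussian)"
      by simp
  qed
  also have "\<dots> = (\<integral>\<^sup>+g. (\<integral>\<^sup>+h. ennreal (slab m g ^ 3) \<partial>std_gaussian) \<partial>std_gaussian)"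
    by (rule std_gaussian_rotation[OF cs c1(2), of "\<lambda>x y. ennreal (slab m x ^ 3)"]) measurable
  also have "\<dots> = (\<integral>\<^sup>+g. ennreal (slab m g ^ 3) \<partial>std_gaussian)"
    by (simp add: std_gaussian.emeasure_space_1[simplified])
  also have "\<dots> = ennreal (\<integral>g. slab m g ^ 3 \<partial>std_gaussian)"
    by (rule nn_integral_eq_integral) auto
  finally show ?thesis
    by (subst (asm) ennreal_le_iff) (auto intro!: integral_nonneg)
qed

lemma slab_product_le:
  assumes l: "0 \<le> l1" "l1 \<le> m" "0 \<le> l2" "l2 \<le> m" "0 \<le> l3" "l3 \<le> m" and m: "m < 1" "0 < m"
  shows "(\<integral>g. slab l1 g * slab l2 g * slab l3 g \<partial>std_gaussian) \<le> (\<integral>g. slab m g ^ 3 \<partial>std_gaussian)"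
proof -
  have amgm: "x * y * z \<le> (x ^ 3 + y ^ 3 + z ^ 3) / 3" if "x \<ge> 0" "y \<ge> 0" "z \<ge> 0" for x y z :: real
  proof -
    \<comment> \<open>The arithmetic-geometric mean inequality for cubes, through the factorisation
      of \<open>x ^ 3 + y ^ 3 + z ^ 3 - 3 * (x * y * z)\<close>.\<close>
    have "0 \<le> (x + y + z) * ((x - y)\<^sup>2 + (y - z)\<^sup>2 + (z - x)\<^sup>2)"
      using that by simp
    also have "\<dots> = 2 * (x ^ 3 + y ^ 3 + z ^ 3 - 3 * (x * y * z))"
      by algebra
    finally show ?thesis by simp
  qed
  have "(\<integral>g. slab l1 g * slab l2 g * slab l3 g \<partial>std_gaussian)
      \<le> (\<integral>g. (slab l1 g ^ 3 + slab l2 g ^ 3 + slab l3 g ^ 3) / 3 \<partial>std_gaussian)"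
    by (rule integral_mono)
       (auto intro!: std_gaussian.integrable_const_bound[where B=1] AE_I2 mult_le_one amgm[simplified])
  also have "\<dots> = ((\<integral>g. slab l1 g ^ 3 \<partial>std_gaussian) + (\<integral>g. slab l2 g ^ 3 \<partial>std_gaussian)
      + (\<integral>g. slab l3 g ^ 3 \<partial>std_gaussian)) / 3"
    by simp
  also have "\<dots> \<le> (\<integral>g. slab m g ^ 3 \<partial>std_gaussian)"
    using slab_cube_mono[OF l(1,2) m] slab_cube_mono[OF l(3,4) m] slab_cube_mono[OF l(5,6) m] by simp
  finally show ?thesis .
qed

section \<open>Moments of the minimum of three Gaussians\<close>

definition gaussian_tail :: "real \<Rightarrow> real" where
  "gaussian_tail t = measure std_gaussian {t..}"

section \<open>The Gaussian tail: symmetry, derivative and limits\<close>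

lemma measure_std_gaussian:
  assumes [measurable]: "A \<in> sets borel"
  shows "measure std_gaussian A = (\<integral>x. std_normal_density x * indicator A x \<partial>lborel)"
proof -
  have "emeasure std_gaussian A = (\<integral>\<^sup>+x. ennreal (std_normal_density x * indicator A x) \<partial>lborel)"
    unfolding std_gaussian_def by (subst emeasure_density) (auto simp: ennreal_mult' intro!: nn_integral_cong split: split_indicator)
  also have "\<dots> = ennreal (\<integral>x. std_normal_density x * indicator A x \<partial>lborel)"
    by (intro nn_integral_eq_integral integrable_real_mult_indicator) auto
  finally show ?thesis
    by (simp add: std_gaussian.emeasure_eq_measure integral_nonneg)
qed

lemma std_gaussian_singleton [simp]: "measure std_gaussian {a} = 0"
proof -
  have "(\<lambda>x. std_normal_density x * indicator {a} x) = (\<lambda>x. std_normal_density a * indicator {a} x)"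
    by (auto simp: indicator_def)
  moreover have "measure std_gaussian {a} = (\<integral>x. std_normal_density x * indicator {a} x \<partial>lborel)"
    by (rule measure_std_gaussian) simp
  ultimately show ?thesis
    by (simp only: integral_mult_right_zero) simp
qed

lemma gaussian_tail_nonneg [simp]: "0 \<le> gaussian_tail t" and gaussian_tail_le_1 [simp]: "gaussian_tail t \<le> 1"
  by (simp_all add: gaussian_tail_def)

lemma std_normal_density_minus [simp]: "std_normal_density (-x) = std_normal_density x"
  by (simp add: std_normal_density_def)

lemma measure_std_gaussian_atMost: "measure std_gaussian {..t} = gaussian_tail (-t)"
proof -
  have "measure std_gaussian {..t} = (\<integral>x. std_normal_density x * indicator {..t} x \<partial>lborel)"
    by (rule measure_std_gaussian) simp
  also have "\<dots> = (\<integral>x. std_normal_density (0 + (-1) * x) * indicator {..t} (0 + (-1) * x) \<partial>lborel)"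
    by (subst lborel_integral_real_affine[where c="-1" and t=0]) simp_all
  also have "\<dots> = (\<integral>x. std_normal_density x * indicator {-t..} x \<partial>lborel)"
    by (intro Bochner_Integration.integral_cong) (auto simp: indicator_def)
  also have "\<dots> = gaussian_tail (-t)"
    unfolding gaussian_tail_def by (rule measure_std_gaussian[symmetric]) simp
  finally show ?thesis .
qed

lemma gaussian_tail_minus: "gaussian_tail (-t) = 1 - gaussian_tail t"
proof -
  have "gaussian_tail (-t) = measure std_gaussian {..t}"
    by (simp add: measure_std_gaussian_atMost)
  also have "{..t} = {..<t} \<union> {t}" by auto
  also have "measure std_gaussian \<dots> = measure std_gaussian {..<t}"
    by (subst std_gaussian.finite_measure_Union) auto
  also have "{..<t} = space std_gaussian - {t..}" by auto
  also have "measure std_gaussian \<dots> = 1 - gaussian_tail t"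
    unfolding gaussian_tail_def by (rule std_gaussian.prob_compl) simp
  finally show ?thesis .
qed

lemma gaussian_tail_0: "gaussian_tail 0 = 1 / 2"
  using gaussian_tail_minus[of 0] by simp

lemma gaussian_tail_has_derivative: "(gaussian_tail has_real_derivative - std_normal_density t) (at t)"
proof -
  have cont: "continuous_on A std_normal_density" for A
    unfolding std_normal_density_def[abs_def] by (intro continuous_intros) auto
  \<comment> \<open>A base point to the left of \<open>t\<close>: from there on the tail is a
    constant minus an integral, and \<open>t\<close> is interior to
    \<open>{a..t + 1}\<close>.\<close>
  define a where "a = t - 1"
  have eq: "gaussian_tail x = gaussian_tail a - integral {a..x} std_normal_density" if "x \<in> {a..t + 1}" for x
  proof -
    have "gaussian_tail a = measure std_gaussian ({a..<x} \<union> {x..})"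
      using that unfolding gaussian_tail_def by (intro arg_cong[where f="measure _"]) auto
    also have "\<dots> = measure std_gaussian {a..<x} + gaussian_tail x"
      unfolding gaussian_tail_def by (subst std_gaussian.finite_measure_Union) auto
    also have "measure std_gaussian {a..<x} = measure std_gaussian ({a..<x} \<union> {x})"
      by (subst std_gaussian.finite_measure_Union) auto
    also have "{a..<x} \<union> {x} = {a..x}"
      using that by auto
    also have "measure std_gaussian {a..x} = (LINT y:{a..x}|lborel. std_normal_density y)"
      by (subst measure_std_gaussian) (simp_all add: set_lebesgue_integral_def mult.commute)
    also have "\<dots> = integral {a..x} std_normal_density"
      by (intro set_borel_integral_eq_integral borel_integrable_atLeastAtMost')
         (rule cont)
    finally show ?thesis by simp
  qed
  have "((\<lambda>x. gaussian_tail a - integral {a..x} std_normal_density) has_real_derivative - std_normal_density t)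
      (at t within {a..t + 1})"
    by (rule DERIV_cong[OF DERIV_diff[OF DERIV_const integral_has_real_derivative[OF cont]]])
       (simp_all add: a_def)
  then have "(gaussian_tail has_real_derivative - std_normal_density t) (at t within {a..t + 1})"
    by (rule has_field_derivative_transform_within[OF _ zero_less_one _ eq[symmetric]]) (simp_all add: a_def)
  moreover have "at t within {a..t + 1} = at t"
    by (rule at_within_interior) (simp add: a_def)
  ultimately show ?thesis by simp
qed

lemmas gaussian_tail_derivative [derivative_intros] = DERIV_chain2[OF gaussian_tail_has_derivative]

lemma std_normal_density_derivative: "(std_normal_density has_real_derivative - x * std_normal_density x) (at x)"
  unfolding std_normal_density_def[abs_def] by (auto intro!: derivative_eq_intros simp: field_simps)

lemma isCont_gaussian_tail: "isCont gaussian_tail x"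
  by (rule DERIV_isCont[OF gaussian_tail_has_derivative])

lemma isCont_std_normal_density: "isCont std_normal_density x"
  by (rule DERIV_isCont[OF std_normal_density_derivative])

lemma borel_measurable_gaussian_tail [measurable]: "gaussian_tail \<in> borel_measurable borel"
  by (intro borel_measurable_continuous_onI continuous_at_imp_continuous_on ballI isCont_gaussian_tail)

lemma gaussian_tail_at_top: "(gaussian_tail \<longlongrightarrow> 0) at_top"
proof -
  interpret real_distribution std_gaussian
    by standard auto
  have "((\<lambda>t. 1 - cdf std_gaussian t) \<longlongrightarrow> 1 - 1) at_top"
    by (intro tendsto_intros cdf_lim_at_top_prob)
  moreover have "1 - cdf std_gaussian t = gaussian_tail t" for t
    using gaussian_tail_minus[of t] by (simp add: cdf_def measure_std_gaussian_atMost)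
  ultimately show ?thesis by simp
qed

lemma gaussian_tail_at_bot: "(gaussian_tail \<longlongrightarrow> 1) at_bot"
proof -
  have "((\<lambda>t. 1 - gaussian_tail t) \<longlongrightarrow> 1 - 0) at_top"
    by (intro tendsto_intros gaussian_tail_at_top)
  then show ?thesis
    by (simp add: filterlim_at_bot_mirror gaussian_tail_minus)
qed

section \<open>Moments by integration by parts over the whole line\<close>

lemma std_normal_density_le_1: "std_normal_density x \<le> 1"
proof -
  have "1 \<le> sqrt (2 * pi)"
    using pi_ge_two by simp
  then have "1 / sqrt (2 * pi) \<le> 1" by simp
  then have "(1 / sqrt (2 * pi)) * exp (- x\<^sup>2 / 2) \<le> 1 * 1"
    by (intro mult_mono) auto
  then show ?thesis by (simp add: std_normal_density_def)
qed

text \<open>The fundamental theorem is applied on \<open>{- real n..real n}\<close>, and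
  integrability allows passing to the limit by dominated convergence.\<close>

lemma integral_FTC_real_line:
  fixes F f :: "real \<Rightarrow> real"
  assumes F: "\<And>x. (F has_real_derivative f x) (at x)" and cont: "\<And>x. isCont f x"
    and int: "integrable lborel f" and lim: "(F \<longlongrightarrow> A) at_bot" "(F \<longlongrightarrow> B) at_top"
  shows "(\<integral>x. f x \<partial>lborel) = B - A"
proof (rule LIMSEQ_unique)
  have [measurable]: "f \<in> borel_measurable lborel"
    using int by simp
  show "(\<lambda>n. \<integral>x. f x * indicator {- real n..real n} x \<partial>lborel) \<longlonglongrightarrow> (\<integral>x. f x \<partial>lborel)"
  proof (rule integral_dominated_convergence[where w="\<lambda>x. \<bar>f x\<bar>"])
    show "AE x in lborel. (\<lambda>n. f x * indicator {- real n..real n} x) \<longlonglongrightarrow> f x"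
    proof (rule AE_I2)
      fix x
      have "eventually (\<lambda>n. f x = f x * indicator {- real n..real n} x) sequentially"
        using eventually_ge_at_top[of "nat \<lceil>\<bar>x\<bar>\<rceil>"]
        by eventually_elim (auto simp: indicator_def nat_le_iff ceiling_le_iff abs_le_iff)
      then show "(\<lambda>n. f x * indicator {- real n..real n} x) \<longlonglongrightarrow> f x"
        by (rule Lim_transform_eventually[OF tendsto_const])
    qed
  qed (use int in \<open>auto simp: indicator_def\<close>)
  have "(\<integral>x. f x * indicator {- real n..real n} x \<partial>lborel) = F (real n) - F (- real n)" for n
    by (rule integral_FTC_Icc_real) (use F cont in auto)
  moreover have "(\<lambda>n. F (real n) - F (- real n)) \<longlonglongrightarrow> B - A"
    by (intro tendsto_diff filterlim_compose[OF lim(2)] filterlim_compose[OF lim(1)] filterlim_real_sequentially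
        filterlim_uminus_at_top[THEN iffD1])
  ultimately show "(\<lambda>n. \<integral>x. f x * indicator {- real n..real n} x \<partial>lborel) \<longlonglongrightarrow> B - A"
    by simp
qed

text \<open>\<open>3 * gmom 0 2 1\<close> is the density of the minimum of three independent
  standard Gaussians, so \<open>3 * GM k 2 1\<close> is its moment of order \<open>k\<close>. The
  further exponents close the family under integration by parts.\<close>

definition gmom :: "nat \<Rightarrow> nat \<Rightarrow> nat \<Rightarrow> real \<Rightarrow> real" where
  "gmom k j i x = x ^ k * gaussian_tail x ^ j * std_normal_density x ^ i"

text \<open>Tails and surplus density factors are at most 1. Keeping one density factor, hence
  \<open>Suc i\<close>, leaves a majorant that gives both integrability and the limits at
  infinity.\<close>

lemma gmom_bound: "\<bar>gmom k j (Suc i) x\<bar> \<le> std_normal_density x * \<bar>x\<bar> ^ k"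
proof -
  have "\<bar>gmom k j (Suc i) x\<bar> = (std_normal_density x * \<bar>x\<bar> ^ k) * (gaussian_tail x ^ j * std_normal_density x ^ i)"
    by (simp add: gmom_def abs_mult power_abs)
  also have "\<dots> \<le> (std_normal_density x * \<bar>x\<bar> ^ k) * (1 * 1)"
    by (intro mult_left_mono mult_mono power_le_one) (auto simp: std_normal_density_le_1)
  finally show ?thesis by simp
qed

lemma integrable_gmom [simp]: "integrable lborel (gmom k j (Suc i))"
proof (rule Bochner_Integration.integrable_bound[OF integrable_std_normal_moment_abs[of k]])
  show "gmom k j (Suc i) \<in> borel_measurable lborel"
    unfolding gmom_def[abs_def] by measurable
  show "AE x in lborel. norm (gmom k j (Suc i) x) \<le> norm (std_normal_density x * \<bar>x\<bar> ^ k)"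
    by (intro AE_I2, unfold real_norm_def) (rule order_trans[OF gmom_bound abs_ge_self])
qed

lemma std_normal_density_power_at_top: "((\<lambda>x. std_normal_density x * \<bar>x\<bar> ^ k) \<longlongrightarrow> 0) at_top"
proof (rule Lim_null_comparison[OF _ tendsto_power_div_exp_0[of k]])
  show "\<forall>\<^sub>F x in at_top. norm (std_normal_density x * \<bar>x\<bar> ^ k) \<le> x ^ k / exp x"
    using eventually_ge_at_top[of 2]
  proof eventually_elim
    case (elim x)
    have "1 \<le> sqrt (2 * pi)"
      using pi_ge_two by simp
    then have "1 / sqrt (2 * pi) * exp (- x\<^sup>2 / 2) \<le> 1 * exp (- x)"
      using elim by (intro mult_mono) (auto simp: power2_eq_square)
    then have "std_normal_density x * x ^ k \<le> exp (-x) * x ^ k"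
      using elim by (intro mult_right_mono) (auto simp: std_normal_density_def)
    then show ?case
      using elim by (simp add: abs_mult exp_minus field_simps)
  qed
qed

lemma gmom_at_top: "(gmom k j (Suc i) \<longlongrightarrow> 0) at_top"
  by (rule Lim_null_comparison[OF _ std_normal_density_power_at_top[of k]]) (simp add: gmom_bound)

lemma gmom_at_bot: "(gmom k j (Suc i) \<longlongrightarrow> 0) at_bot"
proof -
  have "\<bar>gmom k j (Suc i) (-x)\<bar> \<le> std_normal_density x * \<bar>x\<bar> ^ k" for x
    using gmom_bound[of k j i "-x"] by simp
  then show ?thesis
    unfolding filterlim_at_bot_mirror
    by (intro Lim_null_comparison[OF _ std_normal_density_power_at_top[of k]]) simp
qed

lemma isCont_gmom: "isCont (gmom k j i) x"
  unfolding gmom_def[abs_def]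
  by (intro continuous_intros isCont_gaussian_tail isCont_std_normal_density)

abbreviation GM :: "nat \<Rightarrow> nat \<Rightarrow> nat \<Rightarrow> real" where
  "GM k j i \<equiv> (\<integral>x. gmom k j i x \<partial>lborel)"

text \<open>The derivative of \<open>gmom k j (Suc i)\<close> integrates to zero, since the boundary
  terms vanish. For \<open>k = 0\<close> or \<open>j = 0\<close> the truncated \<open>k - 1\<close>
  or \<open>j - 1\<close> stands beside a factor 0.\<close>

lemma GM_by_parts:
  "real k * GM (k - 1) j (Suc i) - real j * GM k (j - 1) (Suc (Suc i)) = real (Suc i) * GM (Suc k) j (Suc i)"
proof -
  have "(\<integral>x. real k * gmom (k - 1) j (Suc i) x - real j * gmom k (j - 1) (Suc (Suc i)) x
      - real (Suc i) * gmom (Suc k) j (Suc i) x \<partial>lborel) = 0 - 0"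
  proof (rule integral_FTC_real_line[OF _ _ _ gmom_at_bot gmom_at_top])
    show "(gmom k j (Suc i) has_real_derivative real k * gmom (k - 1) j (Suc i) x
        - real j * gmom k (j - 1) (Suc (Suc i)) x - real (Suc i) * gmom (Suc k) j (Suc i) x) (at x)" for x
      unfolding gmom_def[abs_def]
      by (rule derivative_eq_intros refl gaussian_tail_has_derivative std_normal_density_derivative)+
         (simp add: algebra_simps)
  qed (auto intro!: continuous_intros isCont_gmom)
  then show ?thesis by simp
qed

text \<open>Reflection turns \<open>gaussian_tail x\<close> into \<open>1 - gaussian_tail x\<close>
  and keeps the even factors.\<close>

lemma GM_reflect:
  assumes "even k"
  shows "GM k 1 (Suc i) = GM k 0 (Suc i) / 2"
proof -
  have "GM k 1 (Suc i) = (\<integral>x. gmom k 1 (Suc i) (0 + (-1) * x) \<partial>lborel)"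
    by (subst lborel_integral_real_affine[where c="-1" and t=0]) simp_all
  also have "\<dots> = (\<integral>x. gmom k 0 (Suc i) x - gmom k 1 (Suc i) x \<partial>lborel)"
    using assms by (intro Bochner_Integration.integral_cong) (auto simp: gmom_def gaussian_tail_minus algebra_simps)
  also have "\<dots> = GM k 0 (Suc i) - GM k 1 (Suc i)"
    by simp
  finally show ?thesis by simp
qed

lemma GM_0_2_1: "GM 0 2 1 = 1 / 3"
proof -
  have "GM 0 2 1 = (\<integral>x. gmom 0 2 (Suc 0) x \<partial>lborel)" by simp
  also have "\<dots> = - (0 ^ 3) / 3 - (- (1 ^ 3) / 3)"
  proof (rule integral_FTC_real_line)
    show "((\<lambda>x. - (gaussian_tail x ^ 3) / 3) has_real_derivative gmom 0 2 (Suc 0) x) (at x)" for x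
      unfolding gmom_def[abs_def]
      by (rule derivative_eq_intros refl gaussian_tail_has_derivative | simp add: numeral_2_eq_2)+
    show "((\<lambda>x. - (gaussian_tail x ^ 3) / 3) \<longlongrightarrow> - (1 ^ 3) / 3) at_bot"
      by (intro tendsto_intros gaussian_tail_at_bot) auto
    show "((\<lambda>x. - (gaussian_tail x ^ 3) / 3) \<longlongrightarrow> - (0 ^ 3) / 3) at_top"
      by (intro tendsto_intros gaussian_tail_at_top) auto
  qed (auto intro: isCont_gmom)
  finally show ?thesis by simp
qed

lemma GM_0_0_2: "GM 0 0 2 = 1 / (2 * sqrt pi)"
proof -
  have "gmom 0 0 2 x = 1 / (2 * sqrt pi) * normal_density 0 (1 / sqrt 2) x" for x
    by (simp add: gmom_def std_normal_density_def normal_density_def power_divide power_mult_distrib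
        mult_exp_exp power2_eq_square real_sqrt_mult real_sqrt_divide field_simps)
  then show ?thesis by simp
qed

lemma GM_0_0_3: "GM 0 0 3 = 1 / (2 * pi * sqrt 3)"
proof -
  have "gmom 0 0 3 x = 1 / (2 * pi * sqrt 3) * normal_density 0 (1 / sqrt 3) x" for x
  proof -
    have "exp (- x\<^sup>2 / 2) ^ 3 = exp (- x\<^sup>2 * 3 / 2)"
      by (simp add: exp_of_nat_mult[symmetric])
    moreover have "sqrt (2 * pi) ^ 3 = 2 * pi * sqrt (2 * pi)"
      by (simp add: power3_eq_cube)
    ultimately show ?thesis
      by (simp add: gmom_def std_normal_density_def normal_density_def power_divide power_mult_distrib
        real_sqrt_mult real_sqrt_divide field_simps)
  qed
  then show ?thesis by simp
qed

text \<open>Integration by parts lowers the power of \<open>x\<close> or of the tail, and reflection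
  removes a single tail factor, until only \<open>GM 0 2 1\<close>, \<open>GM 0 0 2\<close> and
  \<open>GM 0 0 3\<close> are left.\<close>

lemma GM_k_2_1:
  "GM 1 2 1 = - GM 0 0 2" "GM 2 2 1 = 1 / 3 + GM 0 0 3" "GM 3 2 1 = - (5 / 2) * GM 0 0 2"
  "GM 4 2 1 = 1 + 13 / 3 * GM 0 0 3"
proof -
  have 1: "GM 0 1 2 = GM 0 0 2 / 2" "GM 2 1 2 = GM 2 0 2 / 2"
    using GM_reflect[of 0 1] GM_reflect[of 2 1] by (simp_all add: numeral_2_eq_2)
  have 2: "GM 2 0 2 = GM 0 0 2 / 2"
    using GM_by_parts[of 1 0 1] by (simp add: numeral_2_eq_2)
  have 3: "GM 2 0 3 = GM 0 0 3 / 3"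
    using GM_by_parts[of 1 0 2] by (simp add: numeral_2_eq_2 numeral_3_eq_3)
  have 4: "2 * GM 1 1 2 = - GM 0 0 3"
    using GM_by_parts[of 0 1 1] by (simp add: numeral_2_eq_2 numeral_3_eq_3)
  have 5: "2 * GM 3 1 2 = 2 * GM 1 1 2 - GM 2 0 3"
    using GM_by_parts[of 2 1 1] by (simp add: numeral_2_eq_2 numeral_3_eq_3)
  have "GM 1 2 1 = - 2 * GM 0 1 2"
    using GM_by_parts[of 0 2 0] by (simp add: numeral_2_eq_2)
  with 1 show m1: "GM 1 2 1 = - GM 0 0 2" by simp
  have "GM 2 2 1 = GM 0 2 1 - 2 * GM 1 1 2"
    using GM_by_parts[of 1 2 0] by (simp add: numeral_2_eq_2)
  with 4 GM_0_2_1 show m2: "GM 2 2 1 = 1 / 3 + GM 0 0 3" by simp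
  have "GM 3 2 1 = 2 * GM 1 2 1 - 2 * GM 2 1 2"
    using GM_by_parts[of 2 2 0] by (simp add: numeral_2_eq_2 numeral_3_eq_3)
  with 1 2 m1 show "GM 3 2 1 = - (5 / 2) * GM 0 0 2" by simp
  have "GM 4 2 1 = 3 * GM 2 2 1 - 2 * GM 3 1 2"
    using GM_by_parts[of 3 2 0] by (simp add: numeral_eq_Suc)
  with m2 3 4 5 show "GM 4 2 1 = 1 + 13 / 3 * GM 0 0 3" by simp
qed

section \<open>The numerical bound for the extremal loading\<close>

text \<open>\<open>gaussian_tail t ^ 3\<close> is the probability that the minimum of three
  Gaussians is at least \<open>t\<close>; its density form prepares an exchange of
  integrals.\<close>

lemma nn_integral_tail_cube:
  "(\<integral>\<^sup>+x. ennreal (3 * gmom 0 2 1 x) * indicator {t..} x \<partial>lborel) = ennreal (gaussian_tail t ^ 3)"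
proof -
  have "(\<integral>\<^sup>+x. ennreal (3 * gmom 0 2 1 x) * indicator {t..} x \<partial>lborel) = ennreal (- (0 ^ 3) - (- (gaussian_tail t ^ 3)))"
  proof (rule nn_integral_FTC_atLeast)
    show "((\<lambda>x. - (gaussian_tail x ^ 3)) has_real_derivative 3 * gmom 0 2 1 x) (at x)" for x
      unfolding gmom_def[abs_def]
      by (rule derivative_eq_intros refl gaussian_tail_has_derivative | simp add: numeral_2_eq_2)+
    show "((\<lambda>x. - (gaussian_tail x ^ 3)) \<longlongrightarrow> - (0 ^ 3)) at_top"
      by (intro tendsto_intros gaussian_tail_at_top)
    show "(\<lambda>x. 3 * gmom 0 2 1 x) \<in> borel_measurable borel"
      unfolding gmom_def[abs_def] by measurable
    show "0 \<le> 3 * gmom 0 2 1 x" for x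
      by (simp add: gmom_def)
  qed
  then show ?thesis by simp
qed

text \<open>Only the end of \<open>[-1, 1]\<close> towards which \<open>l * g\<close> pushes is kept
  as a constraint; dropping the other end enlarges the event.\<close>

lemma slab_le_tail:
  assumes l: "0 < l" "l < 1"
  shows "slab l g \<le> gaussian_tail ((l * \<bar>g\<bar> - 1) / sqrt (1 - l\<^sup>2))"
proof -
  have k: "sqrt (1 - l\<^sup>2) > 0"
    using l by (simp add: abs_square_less_1)
  let ?t = "(l * \<bar>g\<bar> - 1) / sqrt (1 - l\<^sup>2)"
  show ?thesis
  proof (cases "g \<ge> 0")
    case True
    have "slab l g \<le> measure std_gaussian {..- ?t}"
      unfolding slab_def using True k
      by (intro std_gaussian.finite_measure_mono) (auto simp: field_simps abs_le_iff)
    then show ?thesis by (simp add: measure_std_gaussian_atMost)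
  next
    case False
    have "slab l g \<le> measure std_gaussian {?t..}"
      unfolding slab_def using False k
      by (intro std_gaussian.finite_measure_mono) (auto simp: field_simps abs_le_iff)
    then show ?thesis by (simp add: gaussian_tail_def)
  qed
qed

lemma measure_std_gaussian_abs_le:
  "measure std_gaussian {g. \<bar>g\<bar> \<le> t} = (if t < 0 then 0 else 1 - 2 * gaussian_tail t)"
proof (cases "t < 0")
  case True
  then have "{g. \<bar>g\<bar> \<le> t} = {}" by auto
  then show ?thesis using True by simp
next
  case False
  have "{g. \<bar>g\<bar> \<le> t} = {..t} - {..<-t}"
    using False by auto
  also have "measure std_gaussian \<dots> = measure std_gaussian {..t} - measure std_gaussian {..<-t}"
    using False by (intro std_gaussian.finite_measure_Diff) auto
  also have "measure std_gaussian {..<-t} = measure std_gaussian ({..<-t} \<union> {-t})"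
    by (subst std_gaussian.finite_measure_Union) auto
  also have "{..<-t} \<union> {-t} = {..-t}" by auto
  finally show ?thesis
    using False by (simp add: measure_std_gaussian_atMost gaussian_tail_minus)
qed

text \<open>Write the cubed tail as an integral over the value \<open>x\<close> of the minimum,
  exchange the integrals, and solve the threshold condition for
  \<open>\<bar>g\<bar>\<close>.\<close>

lemma slab_cube_le_nn_integral:
  assumes l: "0 < l" "l < 1"
  shows "ennreal (\<integral>g. slab l g ^ 3 \<partial>std_gaussian)
    \<le> (\<integral>\<^sup>+x. ennreal (3 * gmom 0 2 1 x * measure std_gaussian {g. \<bar>g\<bar> \<le> (1 + sqrt (1 - l\<^sup>2) * x) / l}) \<partial>lborel)"
proof -
  let ?k = "sqrt (1 - l\<^sup>2)"
  have k: "?k > 0"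
    using l by (simp add: abs_square_less_1)
  have [measurable]: "gmom 0 2 1 \<in> borel_measurable borel"
    unfolding gmom_def[abs_def] by measurable
  interpret pair_sigma_finite lborel std_gaussian ..
  have "ennreal (\<integral>g. slab l g ^ 3 \<partial>std_gaussian) = (\<integral>\<^sup>+g. ennreal (slab l g ^ 3) \<partial>std_gaussian)"
    by (rule nn_integral_eq_integral[symmetric]) auto
  also have "\<dots> \<le> (\<integral>\<^sup>+g. ennreal (gaussian_tail ((l * \<bar>g\<bar> - 1) / ?k) ^ 3) \<partial>std_gaussian)"
    by (intro nn_integral_mono ennreal_leI power_mono slab_le_tail l slab_nonneg)
  also have "\<dots> = (\<integral>\<^sup>+g. \<integral>\<^sup>+x. ennreal (3 * gmom 0 2 1 x) * (if (l * \<bar>g\<bar> - 1) / ?k \<le> x then 1 else 0) \<partial>lborel \<partial>std_gaussian)"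
    unfolding nn_integral_tail_cube[symmetric]
    by (intro nn_integral_cong) (simp add: indicator_def)
  also have "\<dots> = (\<integral>\<^sup>+x. \<integral>\<^sup>+g. ennreal (3 * gmom 0 2 1 x) * (if (l * \<bar>g\<bar> - 1) / ?k \<le> x then 1 else 0) \<partial>std_gaussian \<partial>lborel)"
    by (rule Fubini') measurable
  also have "\<dots> = (\<integral>\<^sup>+x. ennreal (3 * gmom 0 2 1 x * measure std_gaussian {g. \<bar>g\<bar> \<le> (1 + ?k * x) / l}) \<partial>lborel)"
  proof (rule nn_integral_cong)
    fix x
    have "(\<integral>\<^sup>+g. ennreal (3 * gmom 0 2 1 x) * (if (l * \<bar>g\<bar> - 1) / ?k \<le> x then 1 else 0) \<partial>std_gaussian)
      = (\<integral>\<^sup>+g. ennreal (3 * gmom 0 2 1 x) * indicator {g. \<bar>g\<bar> \<le> (1 + ?k * x) / l} g \<partial>std_gaussian)"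
      using l k by (intro nn_integral_cong) (auto simp: indicator_def field_simps)
    also have "\<dots> = ennreal (3 * gmom 0 2 1 x) * emeasure std_gaussian {g. \<bar>g\<bar> \<le> (1 + ?k * x) / l}"
      by (rule nn_integral_cmult_indicator) simp
    also have "\<dots> = ennreal (3 * gmom 0 2 1 x * measure std_gaussian {g. \<bar>g\<bar> \<le> (1 + ?k * x) / l})"
      by (simp add: std_gaussian.emeasure_eq_measure ennreal_mult gmom_def)
    finally show "(\<integral>\<^sup>+g. ennreal (3 * gmom 0 2 1 x) * (if (l * \<bar>g\<bar> - 1) / ?k \<le> x then 1 else 0) \<partial>std_gaussian)
      = ennreal (3 * gmom 0 2 1 x * measure std_gaussian {g. \<bar>g\<bar> \<le> (1 + ?k * x) / l})" .
  qed
  finally show ?thesis .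
qed

text \<open>This is the slope of the quartic in \<open>gaussian_tail_quartic\<close> divided by the
  slope of the probability it bounds. Its derivative is nonnegative: an exponential times
  \<open>u\<^sup>2\<close> times a quadratic that is positive by completing the square.\<close>

lemma gaussian_ratio_mono: "mono (\<lambda>u. (1 - u + 3 / 8 * u ^ 3) * exp (((1 + u)\<^sup>2 - 1) / 2 :: real))"
proof (rule monoI)
  fix x y :: real
  assume "x \<le> y"
  then show "(1 - x + 3 / 8 * x ^ 3) * exp (((1 + x)\<^sup>2 - 1) / 2) \<le> (1 - y + 3 / 8 * y ^ 3) * exp (((1 + y)\<^sup>2 - 1) / 2)"
  proof (rule DERIV_nonneg_imp_nondecreasing, intro exI conjI)
    fix u :: real
    show "((\<lambda>u. (1 - u + 3 / 8 * u ^ 3) * exp (((1 + u)\<^sup>2 - 1) / 2)) has_real_derivative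
        u\<^sup>2 * (1 / 32 + 3 / 8 * (u + 1 / 2)\<^sup>2) * exp (((1 + u)\<^sup>2 - 1) / 2)) (at u)"
      by (rule derivative_eq_intros refl | simp)+ (simp add: field_simps power2_eq_square power3_eq_cube)
    show "0 \<le> u\<^sup>2 * (1 / 32 + 3 / 8 * (u + 1 / 2)\<^sup>2) * exp (((1 + u)\<^sup>2 - 1) / 2)"
      by simp
  qed
qed

text \<open>
  The quartic has contact of order three with the left-hand side at \<open>t = 1\<close>; the coefficient
  \<open>3/32\<close> exceeds the Taylor coefficient \<open>1/12\<close> just enough to make the bound global.
\<close>

lemma gaussian_tail_quartic:
  fixes u :: real
  defines "A \<equiv> 2 * std_normal_density 1"
  shows "1 - 2 * gaussian_tail (1 + u) \<le> 1 - 2 * gaussian_tail 1 + A * (u - u\<^sup>2 / 2 + 3 / 32 * u ^ 4)"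
proof -
  define D where "D u = A * (u - u\<^sup>2 / 2 + 3 / 32 * u ^ 4) + 2 * gaussian_tail (1 + u)" for u
  define h where "h u = (1 - u + 3 / 8 * u ^ 3) * exp (((1 + u)\<^sup>2 - 1) / 2)" for u :: real
  have h0: "h 0 = 1" and h: "mono h"
    using gaussian_ratio_mono by (simp_all add: h_def[abs_def])
  have A: "A = 2 * std_normal_density (1 + u) * exp (((1 + u)\<^sup>2 - 1) / 2)" for u
    by (simp add: A_def std_normal_density_def mult_exp_exp diff_divide_distrib)
  have D': "(D has_real_derivative 2 * std_normal_density (1 + u) * (h u - 1)) (at u)" for u
  proof -
    have "(D has_real_derivative A * (1 - u + 3 / 8 * u ^ 3) - 2 * std_normal_density (1 + u)) (at u)"
      unfolding D_def[abs_def]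
      by (rule derivative_eq_intros refl | simp add: field_simps)+
    moreover have "A * (1 - u + 3 / 8 * u ^ 3) = 2 * std_normal_density (1 + u) * h u"
      unfolding A[of u] h_def by simp
    ultimately show ?thesis by (simp add: algebra_simps)
  qed
  \<comment> \<open>\<open>D\<close> has its minimum at 0, because \<open>h\<close> is increasing
    with \<open>h 0 = 1\<close>.\<close>
  have "D 0 \<le> D u"
  proof (cases "u \<ge> 0")
    case True
    then show ?thesis
    proof (rule DERIV_nonneg_imp_nondecreasing, intro exI conjI)
      fix x :: real assume "0 \<le> x"
      then show "0 \<le> 2 * std_normal_density (1 + x) * (h x - 1)"
        using monoD[OF h, of 0 x] h0 by simp
    qed (rule D')
  next
    case False
    then have "u \<le> 0" by simp
    then show ?thesis
    proof (rule DERIV_nonpos_imp_nonincreasing, intro exI conjI)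
      fix x :: real assume "x \<le> 0"
      then show "2 * std_normal_density (1 + x) * (h x - 1) \<le> 0"
        using monoD[OF h, of x 0] h0 by (simp add: mult_nonneg_nonpos)
    qed (rule D')
  qed
  then show ?thesis by (simp add: D_def)
qed

text \<open>For a threshold at least 0 the quartic bound applies directly. For a negative threshold
  the probability is 0 while the quartic may be negative; then
  \<open>\<bar>s * x\<bar> \<ge> 1\<close>, and the term of degree ten outweighs the minimum of the
  quartic. The high degree makes this repair cheap for small \<open>s\<close>.\<close>

lemma measure_std_gaussian_abs_le_poly:
  fixes e s x :: real
  assumes "e \<ge> 0"
  defines "A \<equiv> 2 * std_normal_density 1" and "u \<equiv> e + s * x"
  shows "measure std_gaussian {g. \<bar>g\<bar> \<le> 1 + e + s * x}
    \<le> 1 - 2 * gaussian_tail 1 + A * (u - u\<^sup>2 / 2 + 3 / 32 * u ^ 4) + 5 / 2 * A * (s * x) ^ 10"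
proof -
  have A: "A \<ge> 0" by (simp add: A_def)
  show ?thesis
  proof (cases "1 + e + s * x < 0")
    case True
    have "\<bar>s * x\<bar> \<ge> 1"
      using True assms(1) by linarith
    then have "\<bar>s * x\<bar> ^ 10 \<ge> 1"
      by (rule one_le_power)
    then have "(s * x) ^ 10 \<ge> 1"
      by simp
    \<comment> \<open>With its double zero at the minimiser \<open>u = -2\<close>, this product
      shows that the quartic is at least -5/2.\<close>
    moreover have "0 \<le> 3 / 32 * ((u + 2)\<^sup>2 * ((u - 2)\<^sup>2 + 8 / 3))"
      by simp
    moreover have "3 / 32 * ((u + 2)\<^sup>2 * ((u - 2)\<^sup>2 + 8 / 3)) = u - u\<^sup>2 / 2 + 3 / 32 * u ^ 4 + 5 / 2"
      by (simp add: power2_eq_square algebra_simps eval_nat_numeral)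
    ultimately have "0 \<le> u - u\<^sup>2 / 2 + 3 / 32 * u ^ 4 + 5 / 2 * (s * x) ^ 10"
      by linarith
    with A have "0 \<le> A * (u - u\<^sup>2 / 2 + 3 / 32 * u ^ 4 + 5 / 2 * (s * x) ^ 10)"
      by (rule mult_nonneg_nonneg)
    moreover have "gaussian_tail 1 \<le> gaussian_tail 0"
      unfolding gaussian_tail_def by (intro std_gaussian.finite_measure_mono) auto
    ultimately show ?thesis
      using True gaussian_tail_0 by (simp add: measure_std_gaussian_abs_le algebra_simps)
  next
    case False
    have "0 \<le> 5 / 2 * A * (s * x) ^ 10"
      using A by simp
    moreover have eq: "1 + e + s * x = 1 + u"
      by (simp add: u_def)
    ultimately show ?thesis
      using False gaussian_tail_quartic[of u]
      unfolding eq measure_std_gaussian_abs_le A_def by (simp only: if_False)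
  qed
qed

section \<open>Rational enclosures of the constants\<close>

lemma exp_ge_Taylor:
  fixes x :: real
  assumes "even n"
  shows "(\<Sum>k<n. x ^ k / fact k) \<le> exp x"
proof -
  obtain t where "exp x = (\<Sum>k<n. x ^ k / fact k) + exp t / fact n * x ^ n"
    using Maclaurin_exp_le[of x n] by auto
  moreover have "exp t / fact n * x ^ n \<ge> 0"
    using assms by (simp add: zero_le_even_power)
  ultimately show ?thesis by simp
qed

lemma exp_le_Taylor:
  fixes x :: real
  assumes "odd n" "x \<le> 0"
  shows "exp x \<le> (\<Sum>k<n. x ^ k / fact k)"
proof -
  obtain t where "exp x = (\<Sum>k<n. x ^ k / fact k) + exp t / fact n * x ^ n"
    using Maclaurin_exp_le[of x n] by auto
  moreover have "exp t / fact n * x ^ n \<le> 0"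
    using assms by (intro mult_nonneg_nonpos) (auto simp: power_le_zero_eq odd_pos)
  ultimately show ?thesis by simp
qed

lemma sqrt_2pi_bounds: "2.506628 \<le> sqrt (2 * pi)" "sqrt (2 * pi) \<le> 2.506629"
proof -
  show "2.506628 \<le> sqrt (2 * pi)"
    by (rule real_le_rsqrt) (use pi_approx in \<open>simp add: power2_eq_square\<close>)
  show "sqrt (2 * pi) \<le> 2.506629"
    by (rule real_le_lsqrt) (use pi_approx in \<open>simp_all add: power2_eq_square\<close>)
qed

text \<open>The Taylor polynomial with seven terms bounds the density from above. Integrated
  termwise over \<open>[0, 1]\<close> it bounds the central mass, and
  \<open>gaussian_tail 0 = 1 / 2\<close> fixes the constant.\<close>

lemma gaussian_tail_1_ge: "1 - 2 * gaussian_tail 1 \<le> 0.682691"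
proof -
  define c where "c = 1 / sqrt (2 * pi)"
  have c: "c \<ge> 0" "c \<le> 1 / 2.506628"
    unfolding c_def by (simp, intro divide_left_mono sqrt_2pi_bounds) auto
  define G where "G t = c * (t - t ^ 3 / 6 + t ^ 5 / 40 - t ^ 7 / 336 + t ^ 9 / 3456 - t ^ 11 / 42240 + t ^ 13 / 599040)
    + gaussian_tail t" for t
  have "G 0 \<le> G 1"
  proof (rule DERIV_nonneg_imp_nondecreasing, simp, intro exI conjI)
    fix t :: real
    let ?S = "1 - t ^ 2 / 2 + t ^ 4 / 8 - t ^ 6 / 48 + t ^ 8 / 384 - t ^ 10 / 3840 + t ^ 12 / 46080"
    show "(G has_real_derivative c * ?S - std_normal_density t) (at t)"
      unfolding G_def[abs_def]
      by (rule derivative_eq_intros refl gaussian_tail_has_derivative | simp add: field_simps)+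
    have "exp (- (t\<^sup>2 / 2)) \<le> (\<Sum>k<7. (- (t\<^sup>2 / 2)) ^ k / fact k)"
      by (rule exp_le_Taylor) simp_all
    also have "\<dots> = ?S"
      by (simp add: eval_nat_numeral lessThan_Suc field_simps)
    finally have "c * exp (- (t\<^sup>2 / 2)) \<le> c * ?S"
      using c by (intro mult_left_mono)
    then show "0 \<le> c * ?S - std_normal_density t"
      by (simp add: std_normal_density_def c_def)
  qed
  then have "1 - 2 * gaussian_tail 1 \<le> 2 * c * (1 - 1 / 6 + 1 / 40 - 1 / 336 + 1 / 3456 - 1 / 42240 + 1 / 599040)"
    by (simp add: G_def gaussian_tail_0)
  also have "\<dots> \<le> 2 * (1 / 2.506628) * (1 - 1 / 6 + 1 / 40 - 1 / 336 + 1 / 3456 - 1 / 42240 + 1 / 599040)"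
    using c by (intro mult_right_mono mult_left_mono) auto
  also have "\<dots> \<le> 0.682691"
    by simp
  finally show ?thesis .
qed

lemma std_normal_density_1_bounds: "0.48394 \<le> 2 * std_normal_density 1" "2 * std_normal_density 1 \<le> 0.48395"
proof -
  have "exp (- (1 / 2)) \<le> (\<Sum>k<7. (- (1 / 2)) ^ k / fact k :: real)"
    by (rule exp_le_Taylor) simp_all
  also have "\<dots> \<le> 0.606533"
    by (simp add: eval_nat_numeral lessThan_Suc)
  finally have e: "exp (- (1 / 2)) \<le> (0.606533 :: real)" .
  have "0.60653 \<le> (\<Sum>k<8. (- (1 / 2)) ^ k / fact k :: real)"
    by (simp add: eval_nat_numeral lessThan_Suc)
  also have "\<dots> \<le> exp (- (1 / 2))"
    by (rule exp_ge_Taylor) simp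
  finally have e': "exp (- (1 / 2)) \<ge> (0.60653 :: real)" .
  have "0.48394 \<le> 2 * (1 / 2.506629) * (0.60653 :: real)"
    by simp
  also have "\<dots> \<le> 2 * (1 / sqrt (2 * pi)) * exp (- (1 / 2))"
    using sqrt_2pi_bounds e' by (intro mult_mono divide_left_mono) auto
  finally show "0.48394 \<le> 2 * std_normal_density 1"
    by (simp add: std_normal_density_def)
  have "2 * (1 / sqrt (2 * pi)) * exp (- (1 / 2)) \<le> 2 * (1 / 2.506628) * (0.606533 :: real)"
    using sqrt_2pi_bounds e by (intro mult_mono divide_left_mono) auto
  also have "\<dots> \<le> 0.48395"
    by simp
  finally show "2 * std_normal_density 1 \<le> 0.48395"
    by (simp add: std_normal_density_def)
qed

text \<open>The threshold is \<open>1 + e + s * x\<close> with \<open>x\<close> distributed as the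
  minimum, so the polynomial bound integrates termwise to moments of the minimum.\<close>

lemma slab_cube_bound_polynomial:
  fixes l e s :: real
  assumes l: "0 < l" "l < 1" and e: "e = 1 / l - 1" and s: "s = sqrt (1 - l\<^sup>2) / l"
  defines "A \<equiv> 2 * std_normal_density 1"
  shows "(\<integral>g. slab l g ^ 3 \<partial>std_gaussian) \<le> 1 - 2 * gaussian_tail 1 +
    A * ((e - e\<^sup>2 / 2 + 3 / 32 * e ^ 4) - 3 * GM 0 0 2 * (s * (1 - e + 3 / 8 * e ^ 3))
      - (1 + 3 * GM 0 0 3) * (s\<^sup>2 * (1 / 2 - 9 / 16 * e\<^sup>2)) - 45 / 16 * (GM 0 0 2 * s ^ 3 * e)
      + (3 + 13 * GM 0 0 3) * (3 / 32 * s ^ 4)) + 5 / 2 * A * s ^ 10 * 2835"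
proof -
  have e0: "e \<ge> 0"
    using l by (simp add: e field_simps)
  have A: "A \<ge> 0"
    by (simp add: A_def)
  \<comment> \<open>Coefficients of the bounding polynomial in powers of \<open>x\<close>.\<close>
  define c0 where "c0 = 1 - 2 * gaussian_tail 1 + A * (e - e\<^sup>2 / 2 + 3 / 32 * e ^ 4)"
  define c1 where "c1 = A * s * (1 - e + 3 / 8 * e ^ 3)"
  define c2 where "c2 = A * s\<^sup>2 * (- 1 / 2 + 9 / 16 * e\<^sup>2)"
  define c3 where "c3 = A * s ^ 3 * (3 / 8 * e)"
  define c4 where "c4 = A * s ^ 4 * (3 / 32)"
  define c10 where "c10 = 5 / 2 * A * s ^ 10"
  define f where "f x = 3 * (c0 * gmom 0 2 1 x + c1 * gmom 1 2 1 x + c2 * gmom 2 2 1 x + c3 * gmom 3 2 1 x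
    + c4 * gmom 4 2 1 x + c10 * gmom 10 2 1 x)" for x
  have int: "integrable lborel (gmom k 2 1)" for k
    using integrable_gmom[of k 2 0] by simp
  have f_int: "integrable lborel f"
    unfolding f_def[abs_def] by (intro integrable_mult_right Bochner_Integration.integrable_add int)
  have pw: "3 * gmom 0 2 1 x * measure std_gaussian {g. \<bar>g\<bar> \<le> (1 + sqrt (1 - l\<^sup>2) * x) / l} \<le> f x" for x
  proof -
    let ?u = "e + s * x"
    let ?p = "1 - 2 * gaussian_tail 1 + A * (?u - ?u\<^sup>2 / 2 + 3 / 32 * ?u ^ 4) + 5 / 2 * A * (s * x) ^ 10"
    have eq: "(1 + sqrt (1 - l\<^sup>2) * x) / l = 1 + e + s * x"
      using l by (simp add: e s field_simps)
    have p: "?p = c0 + c1 * x + c2 * x ^ 2 + c3 * x ^ 3 + c4 * x ^ 4 + c10 * x ^ 10"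
    proof -
      have 1: "?u\<^sup>2 = e\<^sup>2 + 2 * e * s * x + s\<^sup>2 * x\<^sup>2"
        by algebra
      have 2: "?u ^ 4 = e ^ 4 + 4 * e ^ 3 * s * x + 6 * e\<^sup>2 * s\<^sup>2 * x\<^sup>2 + 4 * e * s ^ 3 * x ^ 3 + s ^ 4 * x ^ 4"
        by algebra
      show ?thesis
        unfolding 1 2 c0_def c1_def c2_def c3_def c4_def c10_def power_mult_distrib
        by (simp add: algebra_simps)
    qed
    have g: "gmom 0 2 1 x \<ge> 0" "gmom k 2 1 x = gmom 0 2 1 x * x ^ k" for k
      by (simp_all add: gmom_def)
    have "3 * gmom 0 2 1 x * measure std_gaussian {g. \<bar>g\<bar> \<le> 1 + e + s * x} \<le> 3 * gmom 0 2 1 x * ?p"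
      using measure_std_gaussian_abs_le_poly[OF e0, of s x] g(1) unfolding A_def
      by (intro mult_left_mono) auto
    also have "\<dots> = f x"
      unfolding p f_def g(2)[of 1] g(2)[of 2] g(2)[of 3] g(2)[of 4] g(2)[of 10]
      by (simp add: algebra_simps)
    finally show ?thesis unfolding eq .
  qed
  have f_nonneg: "0 \<le> f x" for x
    by (rule order_trans[OF _ pw]) (simp add: gmom_def)
  have "ennreal (\<integral>g. slab l g ^ 3 \<partial>std_gaussian) \<le> (\<integral>\<^sup>+x. ennreal (f x) \<partial>lborel)"
    by (rule order_trans[OF slab_cube_le_nn_integral[OF l]]) (intro nn_integral_mono ennreal_leI pw)
  also have "\<dots> = ennreal (\<integral>x. f x \<partial>lborel)"
    by (rule nn_integral_eq_integral) (use f_int f_nonneg in auto)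
  finally have "(\<integral>g. slab l g ^ 3 \<partial>std_gaussian) \<le> (\<integral>x. f x \<partial>lborel)"
    by (subst (asm) ennreal_le_iff) (auto intro!: Bochner_Integration.integral_nonneg f_nonneg)
  also have "\<dots> = 3 * (c0 * GM 0 2 1 + c1 * GM 1 2 1 + c2 * GM 2 2 1 + c3 * GM 3 2 1 + c4 * GM 4 2 1 + c10 * GM 10 2 1)"
    unfolding f_def using int by simp
  also have "\<dots> = c0 - 3 * GM 0 0 2 * c1 + (1 + 3 * GM 0 0 3) * c2 - 15 / 2 * GM 0 0 2 * c3 + (3 + 13 * GM 0 0 3) * c4
      + 3 * (c10 * GM 10 2 1)"
    unfolding GM_0_2_1 GM_k_2_1 by (simp add: field_simps)
  also have "\<dots> \<le> c0 - 3 * GM 0 0 2 * c1 + (1 + 3 * GM 0 0 3) * c2 - 15 / 2 * GM 0 0 2 * c3 + (3 + 13 * GM 0 0 3) * c4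
      + c10 * 2835"
  proof -
    \<comment> \<open>A crude bound is enough here: the tail factor is at most 1 and the normal
      moment of order ten is 9 * 7 * 5 * 3 = 945. With the factor 3 of the density this gives
      2835.\<close>
    have "GM 10 2 1 \<le> (\<integral>x. std_normal_density x * x ^ (2 * 5) \<partial>lborel)"
    proof (rule integral_mono)
      show "integrable lborel (\<lambda>x. std_normal_density x * x ^ (2 * 5))"
        by (rule integrable_std_normal_moment)
      show "gmom 10 2 1 x \<le> std_normal_density x * x ^ (2 * 5)" for x
        using gmom_bound[of 10 2 0 x] by simp
    qed (rule int)
    also have "\<dots> = 945"
      unfolding integral_std_normal_moment_even by (simp add: fact_numeral)
    finally have "c10 * GM 10 2 1 \<le> c10 * 945"
      using A by (intro mult_left_mono) (auto simp: c10_def)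
    then show ?thesis by simp
  qed
  also have "\<dots> = 1 - 2 * gaussian_tail 1 +
    A * ((e - e\<^sup>2 / 2 + 3 / 32 * e ^ 4) - 3 * GM 0 0 2 * (s * (1 - e + 3 / 8 * e ^ 3))
      - (1 + 3 * GM 0 0 3) * (s\<^sup>2 * (1 / 2 - 9 / 16 * e\<^sup>2)) - 45 / 16 * (GM 0 0 2 * s ^ 3 * e)
      + (3 + 13 * GM 0 0 3) * (3 / 32 * s ^ 4)) + 5 / 2 * A * s ^ 10 * 2835"
    unfolding c0_def c1_def c2_def c3_def c4_def c10_def by (simp add: field_simps)
  finally show ?thesis .
qed

text \<open>The three contributions are at most 0.682691, -0.062223 and 0.0000199, which add up to
  just under the claimed value.\<close>

lemma slab_cube_numeric: "(\<integral>g. slab (20 / sqrt 409) g ^ 3 \<partial>std_gaussian) \<le> 0.6205"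
proof -
  define l where "l = 20 / sqrt (409 :: real)"
  define e where "e = sqrt 409 / 20 - (1 :: real)"
  define a where "a = GM 0 0 2"
  define b where "b = GM 0 0 3"
  define A where "A = 2 * std_normal_density 1"
  have r: "20.22374 \<le> sqrt (409 :: real)" "sqrt (409 :: real) \<le> 20.22375"
    by (rule real_le_rsqrt, simp add: power2_eq_square) (rule real_le_lsqrt, simp_all add: power2_eq_square)
  have l: "0 < l" "l < 1"
    using r by (auto simp: l_def)
  have l2: "l\<^sup>2 = 400 / 409"
    by (simp add: l_def power_divide)
  have "1 - l\<^sup>2 = (3 / sqrt 409)\<^sup>2"
    unfolding l2 by (simp add: power_divide)
  then have "sqrt (1 - l\<^sup>2) = 3 / sqrt 409"
    by simp
  then have s: "3 / 20 = sqrt (1 - l\<^sup>2) / l"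
    using l by (simp add: l_def)
  have e: "e = 1 / l - 1"
    by (simp add: e_def l_def)
  have eb: "0.011187 \<le> e" "e \<le> 0.0111875"
    using r by (simp_all add: e_def)
  have p: "1.772453 \<le> sqrt pi" "sqrt pi \<le> 1.772454"
    by (rule real_le_rsqrt, use pi_approx in \<open>simp add: power2_eq_square\<close>)
       (rule real_le_lsqrt, use pi_approx in \<open>simp_all add: power2_eq_square\<close>)
  have t: "1.73205 \<le> sqrt (3 :: real)" "sqrt (3 :: real) \<le> 1.732051"
    by (rule real_le_rsqrt, simp add: power2_eq_square) (rule real_le_lsqrt, simp_all add: power2_eq_square)
  have "1 / (2 * 1.772454) \<le> a"
    unfolding a_def GM_0_0_2 using p by (intro divide_left_mono) auto
  then have ab: "0.282094 \<le> a" by simp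
  have pt: "3.141592 * 1.73205 \<le> pi * sqrt 3" "pi * sqrt 3 \<le> 3.141593 * 1.732051"
    by (rule mult_mono; use pi_approx t in simp)+
  have "1 / (2 * (3.141593 * 1.732051)) \<le> 1 / (2 * (pi * sqrt 3))"
    "1 / (2 * (pi * sqrt 3)) \<le> 1 / (2 * (3.141592 * 1.73205))"
    by (rule divide_left_mono; use pt in simp)+
  then have bb: "0.091888 \<le> b" "b \<le> 0.091889"
    unfolding b_def GM_0_0_3 by (simp_all add: mult.assoc)
  \<comment> \<open>The bracket multiplied by \<open>A\<close> in
    \<open>slab_cube_bound_polynomial\<close>, with \<open>s = 3 / 20\<close>.\<close>
  define U where "U = (e - e\<^sup>2 / 2 + 3 / 32 * e ^ 4) - 3 * a * ((3 / 20) * (1 - e + 3 / 8 * e ^ 3))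
      - (1 + 3 * b) * ((3 / 20)\<^sup>2 * (1 / 2 - 9 / 16 * e\<^sup>2)) - 45 / 16 * (a * (3 / 20) ^ 3 * e)
      + (3 + 13 * b) * (3 / 32 * (3 / 20) ^ 4)"
  have U: "U \<le> - 0.128576"
  proof -
    have e2: "0.011187\<^sup>2 \<le> e\<^sup>2" "e\<^sup>2 \<le> 0.0111875\<^sup>2" and e4: "e ^ 4 \<le> 0.0111875 ^ 4" and e3: "0 \<le> e ^ 3"
      using eb by (auto intro!: power_mono)
    have 1: "e - e\<^sup>2 / 2 + 3 / 32 * e ^ 4 \<le> 0.0111875 - 0.011187\<^sup>2 / 2 + 3 / 32 * 0.0111875 ^ 4"
      using eb e2 e4 by linarith
    have "1 - 0.0111875 \<le> 1 - e + 3 / 8 * e ^ 3"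
      using eb e3 by linarith
    then have 2: "3 * 0.282094 * ((3 / 20) * (1 - 0.0111875)) \<le> 3 * a * ((3 / 20) * (1 - e + 3 / 8 * e ^ 3))"
      using ab by (intro mult_mono) auto
    have 3: "(1 + 3 * 0.091888) * ((3 / 20)\<^sup>2 * (1 / 2 - 9 / 16 * 0.0111875\<^sup>2))
        \<le> (1 + 3 * b) * ((3 / 20)\<^sup>2 * (1 / 2 - 9 / 16 * e\<^sup>2))"
      using e2 bb by (intro mult_mono) (auto simp: power2_eq_square)
    have 4: "0.282094 * (3 / 20) ^ 3 * 0.011187 \<le> a * (3 / 20) ^ 3 * e"
      using eb ab by (intro mult_mono) auto
    have 5: "(3 + 13 * b) * (3 / 32 * (3 / 20) ^ 4) \<le> (3 + 13 * 0.091889) * (3 / 32 * (3 / 20) ^ 4)"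
      using bb by (intro mult_right_mono) auto
    have "U \<le> (0.0111875 - 0.011187\<^sup>2 / 2 + 3 / 32 * 0.0111875 ^ 4) - 3 * 0.282094 * ((3 / 20) * (1 - 0.0111875))
      - (1 + 3 * 0.091888) * ((3 / 20)\<^sup>2 * (1 / 2 - 9 / 16 * 0.0111875\<^sup>2)) - 45 / 16 * (0.282094 * (3 / 20) ^ 3 * 0.011187)
      + (3 + 13 * 0.091889) * (3 / 32 * (3 / 20) ^ 4)"
      unfolding U_def using 1 2 3 4 5 by linarith
    also have "\<dots> \<le> - 0.128576"
      by (simp add: eval_nat_numeral)
    finally show ?thesis .
  qed
  have Ab: "0.48394 \<le> A" "A \<le> 0.48395"
    unfolding A_def by (fact std_normal_density_1_bounds)+
  define T where "T = 5 / 2 * A * (3 / 20) ^ 10 * 2835"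
  have "(\<integral>g. slab l g ^ 3 \<partial>std_gaussian) \<le> 1 - 2 * gaussian_tail 1 + A * U + T"
    unfolding T_def U_def A_def a_def b_def by (rule slab_cube_bound_polynomial[OF l e s])
  \<comment> \<open>\<open>U\<close> is negative, so lower bounds on both \<open>A\<close> and
    \<open>- U\<close> give the upper bound on \<open>A * U\<close>.\<close>
  moreover have "0.48394 * 0.128576 \<le> A * (- U)"
    using Ab U by (intro mult_mono) auto
  then have "A * U \<le> - 0.062223"
    by simp
  moreover have "T \<le> 0.0000199"
    using Ab by (simp add: T_def eval_nat_numeral)
  ultimately show ?thesis
    using gaussian_tail_1_ge unfolding l_def by simp
qed

section \<open>Rows and matrices\<close>

text \<open>
  The bounds on the overlaps satisfy \<open>0.97799\<^sup>2 / 0.977985 \<le> 400 / 409\<close>; the loading \<open>l = 20 / 409\<^sup>1\<^sup>/\<^sup>2\<close>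
  is convenient because \<open>(1 - l\<^sup>2)\<^sup>1\<^sup>/\<^sup>2 / l = 3 / 20\<close> is rational.
\<close>

lemma factor_loadings:
  fixes c1 c2 c3 r12 r13 r23 :: real
  assumes c: "0 \<le> c1" "c1 \<le> 1" "0 \<le> c2" "c2 \<le> 1" "0 \<le> c3" "c3 \<le> 1"
    and r: "0.977985 \<le> r12" "r12 \<le> 0.97799" "0.977985 \<le> r13" "r13 \<le> 0.97799" "0.977985 \<le> r23" "r23 \<le> 0.97799"
  obtains l1 l2 l3 where "0 \<le> l1" "l1 \<le> 20 / sqrt 409" "0 \<le> l2" "l2 \<le> 20 / sqrt 409" "0 \<le> l3" "l3 \<le> 20 / sqrt 409"
    "l1 * l2 = c1 * c2 * r12" "l1 * l3 = c1 * c3 * r13" "l2 * l3 = c2 * c3 * r23"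
proof -
  have bound: "0 \<le> c * sqrt (x * y / z) \<and> c * sqrt (x * y / z) \<le> 20 / sqrt 409"
    if "0 \<le> c" "c \<le> 1" "0.977985 \<le> x" "x \<le> 0.97799" "0.977985 \<le> y" "y \<le> 0.97799" "0.977985 \<le> z" for c x y z :: real
  proof -
    have "x * y / z \<le> 0.97799 * 0.97799 / 0.977985"
      using that by (intro frac_le mult_mono) auto
    also have "\<dots> \<le> 400 / 409"
      by simp
    finally have "sqrt (x * y / z) \<le> sqrt (400 / 409)"
      by (rule real_sqrt_le_mono)
    also have "\<dots> = 20 / sqrt 409"
      by (simp add: real_sqrt_divide)
    finally have "c * sqrt (x * y / z) \<le> 1 * (20 / sqrt 409)"
      using that by (intro mult_mono) auto
    then show ?thesis using that by simp
  qed
  have prod: "(c * sqrt (x * y / z)) * (d * sqrt (x * z / y)) = c * d * x" if "0 < x" "0 < y" "0 < z" for c d x y z :: real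
  proof -
    have "sqrt (x * y / z) * sqrt (x * z / y) = sqrt (x * x)"
      using that by (simp add: real_sqrt_mult[symmetric])
    then show ?thesis using that by simp
  qed
  have p: "0 < r12" "0 < r13" "0 < r23" using r by simp_all
  show thesis
  proof (rule that[of "c1 * sqrt (r12 * r13 / r23)" "c2 * sqrt (r12 * r23 / r13)" "c3 * sqrt (r13 * r23 / r12)"])
    show "c1 * sqrt (r12 * r13 / r23) * (c2 * sqrt (r12 * r23 / r13)) = c1 * c2 * r12"
      using prod[of r12 r13 r23 c1 c2] p by simp
    show "c1 * sqrt (r12 * r13 / r23) * (c3 * sqrt (r13 * r23 / r12)) = c1 * c3 * r13"
      using prod[of r13 r12 r23 c1 c3] p by (simp add: mult.commute)
    show "c2 * sqrt (r12 * r23 / r13) * (c3 * sqrt (r13 * r23 / r12)) = c2 * c3 * r23"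
      using prod[of r23 r12 r13 c2 c3] p by (simp add: mult.commute)
  qed (use bound c r in blast)+
qed

lemma row_prob:
  fixes s :: "nat \<Rightarrow> nat \<Rightarrow> real" and t :: "nat \<Rightarrow> real" and a :: nat
  assumes n: "n > 0" and signs: "\<And>i b. i \<in> {1..3} \<Longrightarrow> b < n \<Longrightarrow> (s i b)\<^sup>2 = 1"
    and t: "\<And>i. i \<in> {1..3} \<Longrightarrow> t i \<in> {0..pi / 2}"
    and overlap: "\<And>i j. i \<in> {1..3} \<Longrightarrow> j \<in> {1..3} \<Longrightarrow> i < j \<Longrightarrow>
      0.977985 \<le> dot n (s i) (s j) / real n \<and> dot n (s i) (s j) / real n \<le> 0.97799"
  defines "P \<equiv> Pi\<^sub>M ({0..3} \<times> {a} \<times> {..<n}) (\<lambda>_. std_gaussian)"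
  shows "measure P {w \<in> space P. \<forall>i\<in>{1..3}. \<bar>mat_vec n (interpolated w i (t i)) (s i) a\<bar> \<le> sqrt (real n)} \<le> 0.6205"
proof -
  define J where "J = {0..3::nat} \<times> {a} \<times> {..<n}"
  \<comment> \<open>Coefficients of the \<open>i\<close>-th normalised form in the entries of row
    \<open>a\<close>. They have unit norm by \<open>cos\<close> and \<open>sin\<close>, and since
    different \<open>i\<close> share only matrix 0, their inner products are cosines times
    overlaps.\<close>
  define v where "v i = (\<lambda>(k, a' :: nat, b). (if k = 0 then cos (t i) else if k = i then sin (t i) else 0) * s i b / sqrt (real n))" for i :: nat
  have J: "finite J" by (simp add: J_def)
  have sum_J: "(\<Sum>j\<in>J. f j) = (\<Sum>b<n. f (0, a, b) + f (1, a, b) + f (2, a, b) + f (3, a, b))" for f :: "_ \<Rightarrow> real"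
  proof -
    have "(\<Sum>j\<in>J. f j) = (\<Sum>k\<in>{0..3}. \<Sum>a\<in>{a}. \<Sum>b<n. f (k, a, b))"
      unfolding J_def by (simp add: sum.cartesian_product)
    also have "{0..3::nat} = {0, 1, 2, 3}" by auto
    finally show ?thesis by (simp add: sum.distrib add.assoc)
  qed
  have sq: "(\<Sum>j\<in>J. (v i j)\<^sup>2) = 1" if i: "i \<in> {1, 2, 3}" for i
  proof -
    have "(\<Sum>j\<in>J. (v i j)\<^sup>2) = (\<Sum>b<n. (cos (t i))\<^sup>2 * (s i b)\<^sup>2 / real n + (sin (t i))\<^sup>2 * (s i b)\<^sup>2 / real n)"
      unfolding sum_J using i by (intro sum.cong) (auto simp: v_def power_divide power_mult_distrib)
    also have "\<dots> = (\<Sum>b<n. 1 / real n)"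
      using i by (intro sum.cong) (auto simp: signs add_divide_distrib[symmetric])
    finally show ?thesis using n by simp
  qed
  have prod: "(\<Sum>j\<in>J. v i j * v i' j) = cos (t i) * cos (t i') * (dot n (s i) (s i') / real n)"
    if "i \<in> {1, 2, 3}" "i' \<in> {1, 2, 3}" "i \<noteq> i'" for i i'
  proof -
    have "(\<Sum>j\<in>J. v i j * v i' j) = (\<Sum>b<n. cos (t i) * cos (t i') * (s i b * s i' b / real n))"
      unfolding sum_J using that by (intro sum.cong) (auto simp: v_def)
    then show ?thesis
      by (simp add: dot_def sum_distrib_left sum_divide_distrib)
  qed
  have lin: "\<bar>mat_vec n (interpolated w i (t i)) (s i) a\<bar> \<le> sqrt (real n) \<longleftrightarrow> \<bar>\<Sum>j\<in>J. v i j * w j\<bar> \<le> 1"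
    if "i \<in> {1, 2, 3}" for i w
  proof -
    have "(\<Sum>j\<in>J. v i j * w j) = (\<Sum>b<n. (cos (t i) * w (0, a, b) + sin (t i) * w (i, a, b)) * s i b / sqrt (real n))"
      unfolding sum_J using that by (intro sum.cong) (auto simp: v_def add_divide_distrib algebra_simps)
    also have "\<dots> = mat_vec n (interpolated w i (t i)) (s i) a / sqrt (real n)"
      by (simp add: mat_vec_def interpolated_def sum_divide_distrib)
    finally have "(\<Sum>j\<in>J. v i j * w j) = mat_vec n (interpolated w i (t i)) (s i) a / sqrt (real n)" .
    then show ?thesis using n by (simp add: abs_divide)
  qed
  \<comment> \<open>The range of the angles makes the cosines nonnegative, so nonnegative loadings
    exist.\<close>
  have c: "0 \<le> cos (t i) \<and> cos (t i) \<le> 1" if "i \<in> {1, 2, 3}" for i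
    using t[of i] that by (auto intro!: cos_ge_zero)
  let ?r = "\<lambda>i j. dot n (s i) (s j) / real n"
  obtain l1 l2 l3 where l: "0 \<le> l1" "l1 \<le> 20 / sqrt 409" "0 \<le> l2" "l2 \<le> 20 / sqrt 409" "0 \<le> l3" "l3 \<le> 20 / sqrt 409"
    and ll: "l1 * l2 = cos (t 1) * cos (t 2) * ?r 1 2" "l1 * l3 = cos (t 1) * cos (t 3) * ?r 1 3"
      "l2 * l3 = cos (t 2) * cos (t 3) * ?r 2 3"
    by (rule factor_loadings[of "cos (t 1)" "cos (t 2)" "cos (t 3)" "?r 1 2" "?r 1 3" "?r 2 3"])
       (use c overlap in auto)
  have m: "20 / sqrt 409 < (1 :: real)" "0 < 20 / sqrt (409 :: real)"
    using real_less_rsqrt[of 20 409] by auto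
  have lt: "\<bar>l1\<bar> < 1" "\<bar>l2\<bar> < 1" "\<bar>l3\<bar> < 1"
    using l m(1) by (simp_all only: abs_of_nonneg)
  have "(\<forall>i\<in>{1..3}. \<bar>mat_vec n (interpolated w i (t i)) (s i) a\<bar> \<le> sqrt (real n)) \<longleftrightarrow>
     \<bar>\<Sum>j\<in>J. v 1 j * w j\<bar> \<le> 1 \<and> \<bar>\<Sum>j\<in>J. v 2 j * w j\<bar> \<le> 1 \<and> \<bar>\<Sum>j\<in>J. v 3 j * w j\<bar> \<le> 1" for w
  proof -
    have "{1..3::nat} = {1, 2, 3}" by auto
    then show ?thesis using lin[of 1 w] lin[of 2 w] lin[of 3 w] by simp
  qed
  then have "measure P {w \<in> space P. \<forall>i\<in>{1..3}. \<bar>mat_vec n (interpolated w i (t i)) (s i) a\<bar> \<le> sqrt (real n)}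
    = measure P {w \<in> space P. \<bar>\<Sum>j\<in>J. v 1 j * w j\<bar> \<le> 1 \<and> \<bar>\<Sum>j\<in>J. v 2 j * w j\<bar> \<le> 1 \<and> \<bar>\<Sum>j\<in>J. v 3 j * w j\<bar> \<le> 1}"
    by simp
  also have "\<dots> = (\<integral>g. slab l1 g * slab l2 g * slab l3 g \<partial>std_gaussian)"
    unfolding P_def J_def[symmetric] by (rule one_factor_prob[OF J lt]) (use sq prod ll in auto)
  also have "\<dots> \<le> (\<integral>g. slab (20 / sqrt 409) g ^ 3 \<partial>std_gaussian)"
    by (rule slab_product_le) (use l m in auto)
  also have "\<dots> \<le> 0.6205" by (rule slab_cube_numeric)
  finally show ?thesis .
qed

section \<open>Independence of the rows\<close>

lemma indep_vars_PiM_coordinates: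
  assumes "finite I" "I \<noteq> {}" and N: "\<And>i. i \<in> I \<Longrightarrow> prob_space (N i)"
  shows "prob_space.indep_vars (Pi\<^sub>M I N) N (\<lambda>i \<omega>. \<omega> i) I"
proof -
  interpret prob_space "Pi\<^sub>M I N"
    using N by (rule prob_space_PiM)
  have "distr (Pi\<^sub>M I N) (Pi\<^sub>M I N) (\<lambda>x. restrict x I) = distr (Pi\<^sub>M I N) (Pi\<^sub>M I N) (\<lambda>x. x)"
    by (rule distr_cong) (auto simp: space_PiM PiE_restrict)
  also have "\<dots> = Pi\<^sub>M I N"
    by (rule distr_id)
  also have "\<dots> = Pi\<^sub>M I (\<lambda>i. distr (Pi\<^sub>M I N) (N i) (\<lambda>\<omega>. \<omega> i))"
    by (rule PiM_cong) (simp_all add: distr_PiM_component N)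
  finally show ?thesis
    using assms by (subst indep_vars_iff_distr_eq_PiM') (auto intro: measurable_component_singleton)
qed

text \<open>Restrictions to disjoint blocks are independent because the coordinates are, and each
  has the product measure on its block as its law.\<close>

lemma measure_PiM_blocks:
  fixes N :: "'i \<Rightarrow> 'a measure" and K :: "'b \<Rightarrow> 'i set"
  assumes I: "finite I" "I \<noteq> {}" and N: "\<And>i. prob_space (N i)"
    and L: "finite L" and K: "\<And>l. l \<in> L \<Longrightarrow> K l \<subseteq> I" "disjoint_family_on K L"
    and E: "\<And>l. l \<in> L \<Longrightarrow> E l \<in> sets (Pi\<^sub>M (K l) N)"
  shows "measure (Pi\<^sub>M I N) {\<omega> \<in> space (Pi\<^sub>M I N). \<forall>l\<in>L. restrict \<omega> (K l) \<in> E l}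
    = (\<Prod>l\<in>L. measure (Pi\<^sub>M (K l) N) (E l))"
proof -
  interpret Q: prob_space "Pi\<^sub>M I N"
    using N by (rule prob_space_PiM)
  interpret P: product_prob_space N
    by (intro product_prob_spaceI N)
  show ?thesis
  proof (cases "L = {}")
    case True
    then show ?thesis using Q.prob_space by simp
  next
    case False
    have ind: "Q.indep_vars (\<lambda>l. Pi\<^sub>M (K l) N) (\<lambda>l \<omega>. restrict (\<lambda>i. \<omega> i) (K l)) L"
      by (rule Q.indep_vars_restrict[OF indep_vars_PiM_coordinates[OF I N] K])
    have "{\<omega> \<in> space (Pi\<^sub>M I N). \<forall>l\<in>L. restrict \<omega> (K l) \<in> E l}
        = (\<Inter>l\<in>L. (\<lambda>\<omega>. restrict \<omega> (K l)) -` E l \<inter> space (Pi\<^sub>M I N))"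
      using False by auto
    also have "Q.prob \<dots> = (\<Prod>l\<in>L. Q.prob ((\<lambda>\<omega>. restrict \<omega> (K l)) -` E l \<inter> space (Pi\<^sub>M I N)))"
      by (rule Q.indep_varsD_finite[OF ind False L E])
    also have "\<dots> = (\<Prod>l\<in>L. measure (Pi\<^sub>M (K l) N) (E l))"
    proof (rule prod.cong)
      fix l assume l: "l \<in> L"
      have "measure (Pi\<^sub>M (K l) N) (E l) = measure (distr (Pi\<^sub>M I N) (Pi\<^sub>M (K l) N) (\<lambda>\<omega>. restrict \<omega> (K l))) (E l)"
        using P.distr_restrict[OF K(1)[OF l] I(1)] by simp
      also have "\<dots> = Q.prob ((\<lambda>\<omega>. restrict \<omega> (K l)) -` E l \<inter> space (Pi\<^sub>M I N))"
        by (rule measure_distr) (use K(1)[OF l] E[OF l] in \<open>auto intro: measurable_restrict_subset\<close>)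
      finally show "Q.prob ((\<lambda>\<omega>. restrict \<omega> (K l)) -` E l \<inter> space (Pi\<^sub>M I N)) = measure (Pi\<^sub>M (K l) N) (E l)" ..
    qed simp
    finally show ?thesis .
  qed
qed

lemma sup_norm_le_iff:
  assumes "c \<ge> 0"
  shows "sup_norm M v \<le> c \<longleftrightarrow> (\<forall>a<M. \<bar>v a\<bar> \<le> c)"
  using assms by (auto simp: sup_norm_def)

lemma measurable_mat_vec_interpolated:
  assumes "\<And>b. b < n \<Longrightarrow> (0, a, b) \<in> I" "\<And>b. b < n \<Longrightarrow> (i, a, b) \<in> I"
  shows "(\<lambda>\<omega>. mat_vec n (interpolated \<omega> i t) s a) \<in> borel_measurable (Pi\<^sub>M I (\<lambda>_. std_gaussian))"
proof -
  have "(\<lambda>\<omega>. \<omega> j) \<in> borel_measurable (Pi\<^sub>M I (\<lambda>_. std_gaussian))" if "j \<in> I" for j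
    using measurable_component_singleton[OF that, of "\<lambda>_. std_gaussian"]
    by (simp add: measurable_cong_sets[OF refl sets_std_gaussian])
  then show ?thesis
    unfolding mat_vec_def interpolated_def using assms
    by (intro borel_measurable_sum borel_measurable_times borel_measurable_add borel_measurable_const) auto
qed

text \<open>The norm constraint is a conjunction over rows, and row \<open>a\<close> reads only the
  block \<open>K a\<close> of the sample. The blocks are disjoint, so the bound for one row is
  raised to the power \<open>M\<close>. Measurability serves the later union bound.\<close>

lemma matrix_prob:
  fixes s :: "nat \<Rightarrow> nat \<Rightarrow> real" and t :: "nat \<Rightarrow> real" and M :: nat
  assumes n: "n > 0" and signs: "\<And>i b. i \<in> {1..3} \<Longrightarrow> b < n \<Longrightarrow> (s i b)\<^sup>2 = 1"
    and t: "\<And>i. i \<in> {1..3} \<Longrightarrow> t i \<in> {0..pi / 2}"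
    and overlap: "\<And>i j. i \<in> {1..3} \<Longrightarrow> j \<in> {1..3} \<Longrightarrow> i < j \<Longrightarrow>
      0.977985 \<le> dot n (s i) (s j) / real n \<and> dot n (s i) (s j) / real n \<le> 0.97799"
  defines "P \<equiv> gaussian_matrices 3 M n"
  shows "measure P {\<omega> \<in> space P. \<forall>i\<in>{1..3}. sup_norm M (mat_vec n (interpolated \<omega> i (t i)) (s i)) \<le> sqrt (real n)}
      \<le> 0.6205 ^ M"
    and "{\<omega> \<in> space P. \<forall>i\<in>{1..3}. sup_norm M (mat_vec n (interpolated \<omega> i (t i)) (s i)) \<le> sqrt (real n)} \<in> sets P"
proof -
  let ?S = "{\<omega> \<in> space P. \<forall>i\<in>{1..3}. sup_norm M (mat_vec n (interpolated \<omega> i (t i)) (s i)) \<le> sqrt (real n)}"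
  define K where "K a = {0..3::nat} \<times> {a :: nat} \<times> {..<n}" for a
  let ?I = "{0..3::nat} \<times> {..<M} \<times> {..<n}"
  let ?Q = "\<lambda>a. Pi\<^sub>M (K a) (\<lambda>_. std_gaussian)"
  define E where "E a = {w \<in> space (?Q a). \<forall>i\<in>{1..3}. \<bar>mat_vec n (interpolated w i (t i)) (s i) a\<bar> \<le> sqrt (real n)}" for a
  have E: "E a \<in> sets (?Q a)" for a
    unfolding E_def
    by (intro sets.sets_Collect_finite_All borel_measurable_le borel_measurable_abs measurable_mat_vec_interpolated)
       (auto simp: K_def)
  have eq: "?S
      = {\<omega> \<in> space P. \<forall>a\<in>{..<M}. restrict \<omega> (K a) \<in> E a}"
  proof -
    have "mat_vec n (interpolated (restrict \<omega> (K a)) i (t i)) (s i) a = mat_vec n (interpolated \<omega> i (t i)) (s i) a"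
      if "i \<in> {1..3}" for \<omega> i a
      using that unfolding mat_vec_def interpolated_def by (intro sum.cong) (auto simp: K_def)
    then show ?thesis
      by (auto simp: E_def sup_norm_le_iff space_PiM)
  qed
  show "measure P ?S \<le> 0.6205 ^ M"
  proof (cases "M = 0")
    \<comment> \<open>Without rows the index set is empty, which the block lemma excludes; the bound
      is then 1.\<close>
    case True
    interpret prob_space P
      unfolding P_def gaussian_matrices_def by (rule prob_space_PiM) (rule std_gaussian.prob_space_axioms)
    show ?thesis using True by simp
  next
    case False
    have "measure P ?S = (\<Prod>a<M. measure (?Q a) (E a))"
      unfolding eq unfolding P_def gaussian_matrices_def
      by (rule measure_PiM_blocks)
         (use False n E in \<open>auto simp: K_def disjoint_family_on_def std_gaussian.prob_space_axioms lessThan_empty_iff\<close>)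
    also have "\<dots> \<le> (\<Prod>a<M. 0.6205)"
    proof (rule prod_mono, intro conjI)
      fix a
      show "measure (?Q a) (E a) \<le> 0.6205"
        unfolding E_def K_def by (rule row_prob[OF n signs t overlap])
    qed simp
    finally show ?thesis by simp
  qed
  show "?S \<in> sets P"
    unfolding eq unfolding P_def gaussian_matrices_def
  proof (intro sets.sets_Collect_finite_All)
    fix a assume "a \<in> {..<M}"
    then have "(\<lambda>\<omega>. restrict \<omega> (K a)) \<in> measurable (Pi\<^sub>M ?I (\<lambda>_. std_gaussian)) (?Q a)"
      by (intro measurable_restrict_subset) (auto simp: K_def)
    from measurable_sets[OF this E[of a]]
    show "{\<omega> \<in> space (Pi\<^sub>M ?I (\<lambda>_. std_gaussian)). restrict \<omega> (K a) \<in> E a} \<in> sets (Pi\<^sub>M ?I (\<lambda>_. std_gaussian))"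
      by (simp add: vimage_def Int_def conj_commute)
  qed simp
qed

section \<open>Counting triples of sign vectors\<close>

lemma finite_sign_cube [simp]: "finite (sign_cube n)"
  unfolding sign_cube_def by (intro finite_PiE) auto

text \<open>Distributivity, used once for each of the three vectors, exchanges the sum over the cube
  with the product over coordinates.\<close>

lemma sum_sign_cube_triples:
  fixes F :: "real \<Rightarrow> real \<Rightarrow> real \<Rightarrow> real"
  shows "(\<Sum>(x, y, z)\<in>sign_cube n \<times> sign_cube n \<times> sign_cube n. \<Prod>b<n. F (x b) (y b) (z b))
    = (\<Sum>u\<in>{-1, 1}. \<Sum>v\<in>{-1, 1}. \<Sum>w\<in>{-1, 1}. F u v w) ^ n"
proof -
  have "(\<Sum>(x, y, z)\<in>sign_cube n \<times> sign_cube n \<times> sign_cube n. \<Prod>b<n. F (x b) (y b) (z b))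
      = (\<Sum>x\<in>sign_cube n. \<Sum>y\<in>sign_cube n. \<Sum>z\<in>sign_cube n. \<Prod>b<n. F (x b) (y b) (z b))"
    by (simp add: sum.cartesian_product)
  also have "\<dots> = (\<Sum>x\<in>sign_cube n. \<Sum>y\<in>sign_cube n. \<Prod>b<n. \<Sum>w\<in>{-1, 1}. F (x b) (y b) w)"
    unfolding sign_cube_def by (subst prod_sum_PiE) auto
  also have "\<dots> = (\<Sum>x\<in>sign_cube n. \<Prod>b<n. \<Sum>v\<in>{-1, 1}. \<Sum>w\<in>{-1, 1}. F (x b) v w)"
    unfolding sign_cube_def by (subst prod_sum_PiE[of _ _ "\<lambda>b v. \<Sum>w\<in>{-1, 1}. F (_ b) v w"]) auto
  also have "\<dots> = (\<Prod>b<n. \<Sum>u\<in>{-1, 1}. \<Sum>v\<in>{-1, 1}. \<Sum>w\<in>{-1, 1}. F u v w)"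
    unfolding sign_cube_def by (subst prod_sum_PiE[of _ _ "\<lambda>b u. \<Sum>v\<in>{-1, 1}. \<Sum>w\<in>{-1, 1}. F u v w"]) auto
  finally show ?thesis by simp
qed

text \<open>An exponential Markov bound for counting: with tilt \<open>\<theta>\<close>, every
  counted triple has weight at least 1, and the total weight factorises over the
  coordinates.\<close>

lemma card_overlapping_triples:
  fixes \<rho> \<theta> :: real
  assumes "\<theta> \<ge> 0"
  shows "real (card {(x, y, z) \<in> sign_cube n \<times> sign_cube n \<times> sign_cube n.
      \<rho> * real n \<le> dot n x y \<and> \<rho> * real n \<le> dot n x z \<and> \<rho> * real n \<le> dot n y z})
    \<le> (2 * exp (3 * \<theta> * (1 - \<rho>)) * (1 + 3 * exp (- 4 * \<theta>))) ^ n"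
proof -
  let ?C = "sign_cube n \<times> sign_cube n \<times> sign_cube n"
  let ?G = "{(x, y, z) \<in> ?C. \<rho> * real n \<le> dot n x y \<and> \<rho> * real n \<le> dot n x z \<and> \<rho> * real n \<le> dot n y z}"
  define F where "F u v w = exp (\<theta> * (u * v + u * w + v * w - 3 * \<rho>))" for u v w :: real
  have F: "(\<Prod>b<n. F (x b) (y b) (z b)) = exp (\<theta> * (dot n x y + dot n x z + dot n y z - 3 * (\<rho> * real n)))" for x y z
    unfolding F_def dot_def
    by (simp add: exp_sum[symmetric] sum_distrib_left[symmetric] sum.distrib sum_subtractf algebra_simps)
  have "real (card ?G) = (\<Sum>p\<in>?G. 1)"
    by simp
  also have "\<dots> \<le> (\<Sum>(x, y, z)\<in>?G. \<Prod>b<n. F (x b) (y b) (z b))"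
  proof (rule sum_mono, clarify)
    fix x y z
    assume "\<rho> * real n \<le> dot n x y" "\<rho> * real n \<le> dot n x z" "\<rho> * real n \<le> dot n y z"
    then have "0 \<le> \<theta> * (dot n x y + dot n x z + dot n y z - 3 * (\<rho> * real n))"
      using assms by (intro mult_nonneg_nonneg) auto
    then show "1 \<le> (\<Prod>b<n. F (x b) (y b) (z b))"
      unfolding F by simp
  qed
  also have "\<dots> \<le> (\<Sum>(x, y, z)\<in>?C. \<Prod>b<n. F (x b) (y b) (z b))"
    by (rule sum_mono2) (auto simp: F)
  also have "\<dots> = (\<Sum>u\<in>{-1, 1}. \<Sum>v\<in>{-1, 1}. \<Sum>w\<in>{-1, 1}. F u v w) ^ n"
    by (rule sum_sign_cube_triples)
  \<comment> \<open>Of the eight sign patterns, two have pairwise products summing to 3 and six have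
    sum -1.\<close>
  also have "(\<Sum>u\<in>{-1, 1}. \<Sum>v\<in>{-1, 1}. \<Sum>w\<in>{-1, 1}. F u v w)
      = 2 * exp (\<theta> * (3 - 3 * \<rho>)) + 6 * exp (\<theta> * (- 1 - 3 * \<rho>))"
    by (simp add: F_def)
  also have "\<dots> = 2 * exp (3 * \<theta> * (1 - \<rho>)) * (1 + 3 * exp (- 4 * \<theta>))"
    by (simp add: algebra_simps exp_add[symmetric])
  finally show ?thesis .
qed

text \<open>Each bound compares with a Taylor partial sum lying below \<open>exp\<close>. The number
  \<open>61 / 30\<close> is \<open>2 * (1 + 3 / 180)\<close>, from the counting bound at
  \<open>exp (4 * \<theta>) = 180\<close>.\<close>

lemma ln_numerics:
  "ln (61 / 30) \<le> (0.709678 :: real)" "ln 180 \<le> (5.193 :: real)" "ln 0.6205 \<le> (- 0.47722 :: real)"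
proof -
  have ln_le: "ln x \<le> y" if "0 < x" "x \<le> exp y" for x y :: real
    using that ln_le_cancel_iff[of x "exp y"] by simp
  have "(61 / 30 :: real) \<le> (\<Sum>k<10. 0.709678 ^ k / fact k)"
    by (simp add: eval_nat_numeral lessThan_Suc)
  also have "\<dots> \<le> exp 0.709678"
    by (rule exp_ge_Taylor) simp
  finally show "ln (61 / 30) \<le> (0.709678 :: real)"
    by (intro ln_le) simp_all
  \<comment> \<open>0.649125 is 5.193 / 8: a short Taylor sum suffices for the small argument, and
    the eighth power follows.\<close>
  have "1.91386 \<le> (\<Sum>k<8. 0.649125 ^ k / fact k :: real)"
    by (simp add: eval_nat_numeral lessThan_Suc)
  also have "\<dots> \<le> exp 0.649125"
    by (rule exp_ge_Taylor) simp
  finally have "1.91386 ^ 8 \<le> exp (0.649125 :: real) ^ 8"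
    by (intro power_mono) auto
  also have "\<dots> = exp 5.193"
    by (simp add: exp_of_nat_mult[symmetric])
  finally have "180 \<le> exp (5.193 :: real)"
    by (simp add: eval_nat_numeral)
  then show "ln 180 \<le> (5.193 :: real)"
    by (intro ln_le) simp_all
  have "exp (- 0.47722) \<ge> (\<Sum>k<10. (- 0.47722) ^ k / fact k :: real)"
    by (rule exp_ge_Taylor) simp
  moreover have "(\<Sum>k<10. (- 0.47722) ^ k / fact k :: real) \<ge> 0.6205"
    by (simp add: eval_nat_numeral lessThan_Suc)
  ultimately have "0.6205 \<le> exp (- 0.47722 :: real)"
    by linarith
  then show "ln 0.6205 \<le> (- 0.47722 :: real)"
    by (intro ln_le) simp_all
qed

text \<open>
  The optimal \<open>\<theta>\<close> in the counting bound has \<open>exp (4 * \<theta>) = (1 + 3 * \<rho>) / (1 - \<rho>)\<close>, which is about \<open>180\<close>.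
\<close>

lemma first_moment_exponent:
  "2 * exp (3 * (ln 180 / 4) * (1 - 0.977985)) * (1 + 3 * exp (- 4 * (ln 180 / 4))) * exp (1.667 * ln 0.6205)
    \<le> exp (- 0.0001 :: real)"
proof -
  have "exp (- 4 * (ln 180 / 4)) = (1 / 180 :: real)"
    by (simp add: exp_minus inverse_eq_divide)
  then have "2 * exp (3 * (ln 180 / 4) * (1 - 0.977985)) * (1 + 3 * exp (- 4 * (ln 180 / 4))) * exp (1.667 * ln 0.6205)
      = exp (ln (61 / 30)) * exp (3 * (ln 180 / 4) * (1 - 0.977985)) * exp (1.667 * ln (0.6205 :: real))"
    by simp
  also have "\<dots> = exp (ln (61 / 30) + 3 * (ln 180 / 4) * (1 - 0.977985) + 1.667 * ln (0.6205 :: real))"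
    by (simp add: exp_add)
  \<comment> \<open>The three terms are bounded by about 0.709678, 0.085743 and -0.795526, whose sum
    is barely below -0.0001.\<close>
  also have "\<dots> \<le> exp (- 0.0001)"
    unfolding exp_le_cancel_iff using ln_numerics by simp
  finally show ?thesis .
qed

section \<open>The first moment bound\<close>

text \<open>A union bound over admissible sign triples and angle triples. The former number at most
  \<open>C ^ n\<close>, the latter \<open>card \<I> ^ 3\<close>, and each single event has
  probability at most \<open>0.6205 ^ M\<close>.\<close>

lemma measure_solution_tuples_le:
  fixes \<alpha> :: real and \<I> :: "real set" and n :: nat
  assumes \<alpha>: "1.667 \<le> \<alpha>" and n: "n > 0" and \<I>: "\<I> \<subseteq> {0..pi / 2}" "finite \<I>"
  defines "P \<equiv> gaussian_matrices 3 (num_constraints \<alpha> n) n"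
  shows "measure P {\<omega> \<in> space P. solution_tuples 0.97799 0.000005 3 \<alpha> \<I> n \<omega> \<noteq> {}}
    \<le> real (card \<I>) ^ 3 * exp (- 0.0001 * real n) * 2"
proof -
  define M where "M = num_constraints \<alpha> n"
  interpret prob_space P
    unfolding P_def gaussian_matrices_def by (rule prob_space_PiM) (rule std_gaussian.prob_space_axioms)
  \<comment> \<open>The lower end 0.977985 of the overlap window is 0.97799 - 0.000005.\<close>
  define G where "G = {\<sigma> \<in> {1..3::nat} \<rightarrow>\<^sub>E sign_cube n. \<forall>i\<in>{1..3}. \<forall>j\<in>{1..3}. i < j \<longrightarrow>
    0.977985 \<le> dot n (\<sigma> i) (\<sigma> j) / real n \<and> dot n (\<sigma> i) (\<sigma> j) / real n \<le> 0.97799}"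
  define T where "T = ({1..3::nat} \<rightarrow>\<^sub>E \<I>)"
  define Ev where "Ev = (\<lambda>(\<sigma>, \<tau>). {\<omega> \<in> space P. \<forall>i\<in>{1..3}.
    sup_norm M (mat_vec n (interpolated \<omega> i (\<tau> i)) (\<sigma> i)) \<le> sqrt (real n)})"
  define C where "C = 2 * exp (3 * (ln 180 / 4) * (1 - 0.977985)) * (1 + 3 * exp (- 4 * (ln 180 / 4 :: real)))"
  have "finite ({1..3::nat} \<rightarrow>\<^sub>E sign_cube n)"
    by (intro finite_PiE) auto
  then have fin: "finite G" "finite T"
    unfolding G_def T_def using \<I>(2) by (auto intro!: finite_PiE simp del: One_nat_def)
  have Ev: "measure P (Ev p) \<le> 0.6205 ^ M" "Ev p \<in> sets P" if p0: "p \<in> G \<times> T" for p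
  proof -
    obtain \<sigma> \<tau> where p: "p = (\<sigma>, \<tau>)" "\<sigma> \<in> G" "\<tau> \<in> T"
      using p0 by auto
    have "(\<sigma> i b)\<^sup>2 = 1" if "i \<in> {1..3}" "b < n" for i b
    proof -
      have "\<sigma> i b \<in> {-1, 1}"
        using p(2) that unfolding G_def sign_cube_def by fastforce
      then show ?thesis by auto
    qed
    moreover have "\<tau> i \<in> {0..pi / 2}" if "i \<in> {1..3}" for i
      using PiE_mem[of \<tau> "{1..3}" "\<lambda>_. \<I>" i] p(3) that \<I>(1) unfolding T_def by blast
    moreover have "0.977985 \<le> dot n (\<sigma> i) (\<sigma> j) / real n \<and> dot n (\<sigma> i) (\<sigma> j) / real n \<le> 0.97799"
      if "i \<in> {1..3}" "j \<in> {1..3}" "i < j" for i j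
      using p(2) that unfolding G_def by blast
    ultimately show "measure P (Ev p) \<le> 0.6205 ^ M" "Ev p \<in> sets P"
      using matrix_prob[of n \<sigma> \<tau> M] n unfolding p Ev_def P_def M_def[symmetric] by auto
  qed
  have card_G: "real (card G) \<le> C ^ n"
  proof -
    let ?H = "{(x, y, z) \<in> sign_cube n \<times> sign_cube n \<times> sign_cube n.
      0.977985 * real n \<le> dot n x y \<and> 0.977985 * real n \<le> dot n x z \<and> 0.977985 * real n \<le> dot n y z}"
    have three: "{1..3::nat} = {1, 2, 3}" by auto
    have "card G \<le> card ?H"
    proof (rule card_inj_on_le)
      show "inj_on (\<lambda>\<sigma>. (\<sigma> 1, \<sigma> 2, \<sigma> 3)) G"
      proof (rule inj_onI)
        fix \<sigma> \<sigma>' assume "\<sigma> \<in> G" "\<sigma>' \<in> G" "(\<sigma> 1, \<sigma> 2, \<sigma> 3) = (\<sigma>' 1, \<sigma>' 2, \<sigma>' 3)"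
        then show "\<sigma> = \<sigma>'"
          unfolding G_def three by (intro PiE_ext[of \<sigma> "{1, 2, 3}" "\<lambda>_. sign_cube n"]) auto
      qed
      show "(\<lambda>\<sigma>. (\<sigma> 1, \<sigma> 2, \<sigma> 3)) ` G \<subseteq> ?H"
        using n unfolding G_def three by (auto simp: field_simps)
      show "finite ?H"
        by (rule finite_subset[of _ "sign_cube n \<times> sign_cube n \<times> sign_cube n"]) auto
    qed
    moreover have "real (card ?H) \<le> C ^ n"
      unfolding C_def by (rule card_overlapping_triples) simp
    ultimately show ?thesis by linarith
  qed
  have "{\<omega> \<in> space P. solution_tuples 0.97799 0.000005 3 \<alpha> \<I> n \<omega> \<noteq> {}} \<subseteq> (\<Union>p\<in>G \<times> T. Ev p)"
  proof (rule subsetI)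
    fix \<omega> assume "\<omega> \<in> {\<omega> \<in> space P. solution_tuples 0.97799 0.000005 3 \<alpha> \<I> n \<omega> \<noteq> {}}"
    then obtain \<sigma> where \<omega>: "\<omega> \<in> space P" and "\<sigma> \<in> solution_tuples 0.97799 0.000005 3 \<alpha> \<I> n \<omega>"
      by blast
    then obtain \<tau> where "\<sigma> \<in> G" "\<tau> \<in> {1..3} \<rightarrow> \<I>"
      "\<forall>i\<in>{1..3}. sup_norm M (mat_vec n (interpolated \<omega> i (\<tau> i)) (\<sigma> i)) \<le> sqrt (real n)"
      unfolding solution_tuples_def G_def M_def by auto
    \<comment> \<open>Restricting \<open>\<tau>\<close> makes it extensional, hence a member of the
      finite set \<open>T\<close>.\<close>
    then have "(\<sigma>, restrict \<tau> {1..3}) \<in> G \<times> T" "\<omega> \<in> Ev (\<sigma>, restrict \<tau> {1..3})"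
      using \<omega> by (auto simp: T_def Ev_def)
    then show "\<omega> \<in> (\<Union>p\<in>G \<times> T. Ev p)" by blast
  qed
  then have "measure P {\<omega> \<in> space P. solution_tuples 0.97799 0.000005 3 \<alpha> \<I> n \<omega> \<noteq> {}} \<le> measure P (\<Union>p\<in>G \<times> T. Ev p)"
    by (rule finite_measure_mono) (use fin Ev(2) in auto)
  also have "\<dots> \<le> (\<Sum>p\<in>G \<times> T. measure P (Ev p))"
    by (rule finite_measure_subadditive_finite) (use fin Ev(2) in auto)
  also have "\<dots> \<le> (\<Sum>p\<in>G \<times> T. 0.6205 ^ M)"
    by (rule sum_mono) (rule Ev(1))
  also have "\<dots> = real (card G) * real (card \<I>) ^ 3 * 0.6205 ^ M"
    by (simp add: card_cartesian_product T_def card_PiE)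
  also have "\<dots> \<le> C ^ n * real (card \<I>) ^ 3 * (exp (1.667 * ln 0.6205) ^ n * 2)"
  proof (intro mult_mono card_G order_refl)
    \<comment> \<open>The floor loses at most one row, that is a factor \<open>1 / 0.6205\<close>,
      which is below 2.\<close>
    have "real M \<ge> 1.667 * real n - 1"
    proof -
      have "1.667 * real n \<le> real n * \<alpha>"
        using mult_left_mono[OF \<alpha>, of "real n"] by simp
      then show ?thesis
        unfolding M_def num_constraints_def by linarith
    qed
    then have "real M * ln 0.6205 \<le> (1.667 * real n - 1) * ln 0.6205"
      by (intro mult_right_mono_neg) (auto intro: order_trans[OF ln_numerics(3)])
    also have "\<dots> = real n * (1.667 * ln 0.6205) - ln 0.6205"
      by (simp add: algebra_simps)
    finally have "exp (real M * ln 0.6205) \<le> exp (real n * (1.667 * ln 0.6205) - ln (0.6205 :: real))"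
      by simp
    also have "\<dots> = exp (1.667 * ln 0.6205) ^ n / 0.6205"
      by (simp only: exp_diff exp_of_nat_mult) simp
    also have "\<dots> \<le> exp (1.667 * ln 0.6205) ^ n * 2"
      by simp
    finally show "0.6205 ^ M \<le> exp (1.667 * ln 0.6205) ^ n * (2 :: real)"
      by (simp only: exp_of_nat_mult) simp
  qed (auto simp: C_def)
  also have "\<dots> = real (card \<I>) ^ 3 * (C * exp (1.667 * ln 0.6205)) ^ n * 2"
    by (simp add: power_mult_distrib)
  also have "\<dots> \<le> real (card \<I>) ^ 3 * exp (- 0.0001) ^ n * 2"
    using first_moment_exponent unfolding C_def[symmetric]
    by (intro mult_mono power_mono) (auto simp: C_def)
  also have "exp (- 0.0001) ^ n = exp (- 0.0001 * real n :: real)"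
    by (simp add: exp_of_nat_mult[symmetric])
  finally show ?thesis .
qed

theorem theorem2p3:
  fixes \<alpha> :: real
  assumes "1.667 \<le> \<alpha>" and "\<alpha> \<le> critical_ratio 1"
  shows "\<exists>(\<eta>::real) (\<beta>::real) (c::real). 0 < \<eta> \<and> \<eta> < \<beta> \<and> \<beta> < 1 \<and> 0 < c \<and>
    (\<exists>(c'::real) (n0::nat). 0 < c' \<and>
      (\<forall>n\<ge>n0. \<forall>\<I>\<subseteq>{0..pi/2}. finite \<I> \<and> real (card \<I>) \<le> 2 powr (c * real n) \<longrightarrow>
        (let P = gaussian_matrices 3 (num_constraints \<alpha> n) n
         in measure P {\<omega> \<in> space P. solution_tuples \<beta> \<eta> 3 \<alpha> \<I> n \<omega> \<noteq> {}})
          \<le> 2 powr (- c' * real n)))"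
proof (rule exI[of _ "0.000005"], rule exI[of _ "0.97799"], rule exI[of _ "0.00001"], intro conjI,
    simp, simp, simp, simp, rule exI[of _ "0.00001"], rule exI[of _ 10000], intro conjI, simp, intro allI impI)
  \<comment> \<open>\<open>\<beta>\<close> and \<open>\<eta>\<close> give the overlap window of the
    row bound. With \<open>c\<close> and \<open>c'\<close> both 0.00001, the cubed number of angles
    and the target rate together use only \<open>4 * 0.00001 * ln 2\<close> of the available 0.0001
    per coordinate.\<close>
  fix n :: nat and \<I> :: "real set"
  assume n: "10000 \<le> n" and \<I>: "\<I> \<subseteq> {0..pi / 2}"
    and card: "finite \<I> \<and> real (card \<I>) \<le> 2 powr (0.00001 * real n)"
  have "real (card \<I>) ^ 3 * exp (- 0.0001 * real n) * 2 \<le> (2 powr (0.00001 * real n)) ^ 3 * exp (- 0.0001 * real n) * 2"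
    using card by (intro mult_right_mono power_mono) auto
  also have "\<dots> = exp (3 * (0.00001 * real n * ln 2)) * exp (- 0.0001 * real n) * exp (ln 2)"
    by (simp add: powr_def exp_of_nat_mult[symmetric])
  also have "\<dots> = exp (3 * (0.00001 * real n * ln 2) - 0.0001 * real n + ln 2)"
    by (simp only: exp_add[symmetric]) simp
  also have "\<dots> \<le> exp (- 0.00001 * real n * ln 2)"
  proof -
    define L where "L = real n * ln 2"
    have "L \<le> real n * (25 / 36)"
      unfolding L_def by (rule mult_left_mono[OF ln2_le_25_over_36]) simp
    \<comment> \<open>The slack is about 0.00007 per coordinate; from \<open>n = 10000\<close> on it
      outweighs the \<open>ln 2\<close> caused by the factor 2.\<close>
    then have "3 * (0.00001 * L) - 0.0001 * real n + ln 2 \<le> - 0.00001 * L"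
      using n ln2_le_25_over_36 by simp
    then show ?thesis
      by (simp add: L_def mult.assoc)
  qed
  also have "\<dots> = 2 powr (- 0.00001 * real n)"
    by (simp add: powr_def)
  finally have "real (card \<I>) ^ 3 * exp (- 0.0001 * real n) * 2 \<le> 2 powr (- 0.00001 * real n)" .
  then show "(let P = gaussian_matrices 3 (num_constraints \<alpha> n) n
      in measure P {\<omega> \<in> space P. solution_tuples 0.97799 0.000005 3 \<alpha> \<I> n \<omega> \<noteq> {}}) \<le> 2 powr (- 0.00001 * real n)"
    unfolding Let_def
    using measure_solution_tuples_le[OF assms(1) _ \<I>, of n] card n by linarith
qed

end
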